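(* Let $k\in\mathbb C$, $k\ne-2$. The residue $S_k=\int S_k(w)\,dw$ of the field $S_k(w)=a(w)V_{-2}(w)$ is an intertwining operator between the $\widehat{\mathfrak{sl}}_2$-modules $W_{0,k}$ and $W_{-2,k}$.
   Context: $\mathfrak{sl}_2$ has standard basis $e,h,f$; levels are written as $k$ for the inner product $k\kappa_0$ with $\kappa_0(h,h)=2$; $x(z)=\sum_n(x\otimes t^n)z^{-n-1}$. $M$ is the Fock module of the Weyl algebra $[a_n,a^*_m]=\delta_{n,-m}$ with $a_n|0\rangle=0$ ($n\ge0$), $a^*_n|0\rangle=0$ ($n>0$); $a(z)=\sum a_nz^{-n-1}$, $a^*(z)=\sum a^*_nz^{-n}$. $\pi^{k+2}_\lambda$ ($\lambda\in\mathbb C$) is the Fock module of the Heisenberg algebra $[b_n,b_m]=2(k+2)n\,\delta_{n,-m}$ generated by $|\lambda\rangle$ with $b_n|\lambda\rangle=0$ ($n>0$), $b_0|\lambda\rangle=\lambda|\lambda\rangle$; $b(z)=\sum b_nz^{-n-1}$. The Wakimoto module is $W_{\lambda,k}=M\otimes\pi^{k+2}_\lambda$, with the $\widehat{\mathfrak{sl}}_2$-action of level $k$ $$e(z)\mapsto a(z),\quad h(z)\mapsto-2:\!a^*(z)a(z)\!:+b(z),\quad f(z)\mapsto-:\!a^*(z)^2a(z)\!:+k\,\partial_za^*(z)+a^*(z)b(z).$$ $V_{-2}(z):\pi_0^{k+2}\to\pi_{-2}^{k+2}$ is $$V_{-2}(z)=T_{-2}\exp\Big(\frac1{k+2}\sum_{n<0}\frac{b_n}nz^{-n}\Big)\exp\Big(\frac1{k+2}\sum_{n>0}\frac{b_n}nz^{-n}\Big),$$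 with $T_{-2}:\pi_0^{k+2}\to\pi_{-2}^{k+2}$ sending highest weight vector to highest weight vector and commuting with $b_n$, $n\ne0$. $\int(\cdot)\,dw$ denotes the coefficient of $w^{-1}$. Intertwining operator means a homomorphism of $\widehat{\mathfrak{sl}}_2$-modules. *)

theory Defs
  imports Complex_Main "HOL-Library.Poly_Mapping"
begin

section \<open>Free complex vector spaces and tensor products\<close>

text \<open>
  The vector space with basis indexed by \<open>'m\<close> is the type \<open>'m \<Rightarrow>\<^sub>0 complex\<close>;
  the basis vector attached to \<open>m\<close> is \<open>Poly_Mapping.single m 1\<close>.
\<close>

definition cscale :: "complex \<Rightarrow> ('m \<Rightarrow>\<^sub>0 complex) \<Rightarrow> ('m \<Rightarrow>\<^sub>0 complex)"
  where "cscale c v = Poly_Mapping.map ((*) c) v"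

abbreviation clin :: "(('m \<Rightarrow>\<^sub>0 complex) \<Rightarrow> ('n \<Rightarrow>\<^sub>0 complex)) \<Rightarrow> bool"
  where "clin \<equiv> Vector_Spaces.linear cscale cscale"

text \<open>The linear map with prescribed values on the basis vectors.\<close>

definition linext :: "('m \<Rightarrow> ('n \<Rightarrow>\<^sub>0 complex)) \<Rightarrow> ('m \<Rightarrow>\<^sub>0 complex) \<Rightarrow> ('n \<Rightarrow>\<^sub>0 complex)"
  where "linext g v = (\<Sum>m\<in>Poly_Mapping.keys v. cscale (Poly_Mapping.lookup v m) (g m))"

text \<open>
  The tensor product of two free vector spaces is free on the pairs of basis elements.
\<close>

definition tensor ::
    "('m \<Rightarrow>\<^sub>0 complex) \<Rightarrow> ('p \<Rightarrow>\<^sub>0 complex) \<Rightarrow> (('m \<times> 'p) \<Rightarrow>\<^sub>0 complex)"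
  where "tensor x y = linext (\<lambda>m. linext (\<lambda>p. Poly_Mapping.single (m, p) 1) y) x"

definition tensor_map ::
    "(('m \<Rightarrow>\<^sub>0 complex) \<Rightarrow> ('m' \<Rightarrow>\<^sub>0 complex)) \<Rightarrow> (('p \<Rightarrow>\<^sub>0 complex) \<Rightarrow> ('p' \<Rightarrow>\<^sub>0 complex)) \<Rightarrow>
     (('m \<times> 'p) \<Rightarrow>\<^sub>0 complex) \<Rightarrow> (('m' \<times> 'p') \<Rightarrow>\<^sub>0 complex)"
  where "tensor_map A B =
    linext (\<lambda>(m, p). tensor (A (Poly_Mapping.single m 1)) (B (Poly_Mapping.single p 1)))"


section \<open>Fock modules\<close>

text \<open>
  Fock modules are realised as polynomial algebras in the creation operators: the vacuum is \<open>1\<close>,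
  creation operators multiply by a variable and annihilation operators are multiples of partial
  derivatives.  The defining relations and cyclicity are verified below
  (\<open>weyl_fock_module\<close>, \<open>heis_fock_module\<close>).
\<close>

type_synonym 'x fock = "('x \<Rightarrow>\<^sub>0 nat) \<Rightarrow>\<^sub>0 complex"

definition vac :: "'x fock"
  where "vac = Poly_Mapping.single 0 1"

definition var_mult :: "'x \<Rightarrow> 'x fock \<Rightarrow> 'x fock"
  where "var_mult x v = Poly_Mapping.single (Poly_Mapping.single x 1) 1 * v"

definition var_deriv :: "'x \<Rightarrow> 'x fock \<Rightarrow> 'x fock"
  where "var_deriv x = linext (\<lambda>m.
    Poly_Mapping.single (m - Poly_Mapping.single x 1) (of_nat (Poly_Mapping.lookup m x)))"

text \<open>
  The variable \<open>Va i\<close> stands for \<open>a\<close> with index \<open>-i-1\<close>, the variable \<open>Vas i\<close> for \<open>a\<^sup>*\<close> with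
  index \<open>-i\<close>.
\<close>

datatype weyl_var = Va nat | Vas nat

type_synonym weyl_fock = "weyl_var fock"

definition a_op :: "int \<Rightarrow> weyl_fock \<Rightarrow> weyl_fock"
  where "a_op n v = (if n < 0 then var_mult (Va (nat (- n - 1))) v else var_deriv (Vas (nat n)) v)"

definition as_op :: "int \<Rightarrow> weyl_fock \<Rightarrow> weyl_fock"
  where "as_op n v =
    (if n \<le> 0 then var_mult (Vas (nat (- n))) v else - var_deriv (Va (nat (n - 1))) v)"

text \<open>
  The variable \<open>i\<close> stands for \<open>b\<close> with index \<open>-i-1\<close>.  The Fock modules of highest weight \<open>\<nu>\<close>
  all live on the same space; \<open>\<kappa>\<close> (which is \<open>k + 2\<close> in the application) and \<open>\<nu>\<close> enter through the
  action only.
\<close>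

type_synonym heis_fock = "nat fock"

definition b_op :: "complex \<Rightarrow> complex \<Rightarrow> int \<Rightarrow> heis_fock \<Rightarrow> heis_fock"
  where "b_op \<kappa> \<nu> n v =
    (if n < 0 then var_mult (nat (- n - 1)) v
     else if n = 0 then cscale \<nu> v
     else cscale (2 * \<kappa> * of_int n) (var_deriv (nat (n - 1)) v))"


section \<open>Formal distributions\<close>

text \<open>
  \<open>A i\<close> is the coefficient of \<open>z\<^sup>i\<close> in \<open>A(z)\<close>, \<open>i\<close> an integer.  Infinite sums of operators are
  taken vectorwise as \<open>Sum_any\<close>, which is meaningful when on each vector only finitely many
  terms are nonzero.
\<close>

type_synonym ('v, 'w) dist = "int \<Rightarrow> 'v \<Rightarrow> 'w"

definition dist_add :: "('v, 'w::plus) dist \<Rightarrow> ('v, 'w) dist \<Rightarrow> ('v, 'w) dist"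
  where "dist_add A B = (\<lambda>i v. A i v + B i v)"

definition dist_scale :: "complex \<Rightarrow> ('v, 'm \<Rightarrow>\<^sub>0 complex) dist \<Rightarrow> ('v, 'm \<Rightarrow>\<^sub>0 complex) dist"
  where "dist_scale c A = (\<lambda>i v. cscale c (A i v))"

definition dist_mult :: "('v, 'w::comm_monoid_add) dist \<Rightarrow> ('u, 'v) dist \<Rightarrow> ('u, 'w) dist"
  where "dist_mult A B = (\<lambda>i v. Sum_any (\<lambda>j. A j (B (i - j) v)))"

definition dist_one :: "('v, 'v::zero) dist"
  where "dist_one = (\<lambda>i v. if i = 0 then v else 0)"

definition dist_deriv :: "('v, 'm \<Rightarrow>\<^sub>0 complex) dist \<Rightarrow> ('v, 'm \<Rightarrow>\<^sub>0 complex) dist"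
  where "dist_deriv A = (\<lambda>i v. cscale (of_int (i + 1)) (A (i + 1) v))"

definition dist_residue :: "('v, 'w) dist \<Rightarrow> 'v \<Rightarrow> 'w"
  where "dist_residue A = A (- 1)"

definition dist_pos :: "('v, 'w::zero) dist \<Rightarrow> ('v, 'w) dist"
  where "dist_pos A = (\<lambda>i v. if i \<ge> 0 then A i v else 0)"

definition dist_neg :: "('v, 'w::zero) dist \<Rightarrow> ('v, 'w) dist"
  where "dist_neg A = (\<lambda>i v. if i < 0 then A i v else 0)"

text \<open>
  \<open>:A(z)B(z): = A(z)\<^sub>+ B(z) + B(z) A(z)\<^sub>-\<close>; products of more factors are nested from the right.
\<close>

definition normal_prod ::
    "('v, 'v::comm_monoid_add) dist \<Rightarrow> ('v, 'v) dist \<Rightarrow> ('v, 'v) dist"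
  where "normal_prod A B = dist_add (dist_mult (dist_pos A) B) (dist_mult B (dist_neg A))"

primrec dist_power :: "('v, 'v::comm_monoid_add) dist \<Rightarrow> nat \<Rightarrow> ('v, 'v) dist"
  where
    "dist_power A 0 = dist_one"
  | "dist_power A (Suc j) = dist_mult A (dist_power A j)"

definition dist_exp ::
    "('m \<Rightarrow>\<^sub>0 complex, 'm \<Rightarrow>\<^sub>0 complex) dist \<Rightarrow> ('m \<Rightarrow>\<^sub>0 complex, 'm \<Rightarrow>\<^sub>0 complex) dist"
  where "dist_exp A = (\<lambda>i v. Sum_any (\<lambda>j. cscale (1 / fact j) (dist_power A j i v)))"


section \<open>The affine Lie algebra of \<open>sl\<^sub>2\<close> and its modules\<close>

datatype sl2_basis = E | H | F

fun sl2_bracket :: "sl2_basis \<Rightarrow> sl2_basis \<Rightarrow> (sl2_basis \<Rightarrow>\<^sub>0 complex)"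
  where
    "sl2_bracket E F = Poly_Mapping.single H 1"
  | "sl2_bracket F E = Poly_Mapping.single H (- 1)"
  | "sl2_bracket H E = Poly_Mapping.single E 2"
  | "sl2_bracket E H = Poly_Mapping.single E (- 2)"
  | "sl2_bracket H F = Poly_Mapping.single F (- 2)"
  | "sl2_bracket F H = Poly_Mapping.single F 2"
  | "sl2_bracket E E = 0"
  | "sl2_bracket H H = 0"
  | "sl2_bracket F F = 0"

text \<open>The invariant inner product with \<open>\<kappa>\<^sub>0(h,h) = 2\<close>, i.e. the trace form of the defining representation.\<close>

fun kappa0 :: "sl2_basis \<Rightarrow> sl2_basis \<Rightarrow> complex"
  where
    "kappa0 H H = 2"
  | "kappa0 E F = 1"
  | "kappa0 F E = 1"
  | "kappa0 _ _ = 0"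

text \<open>\<open>Loop x n\<close> stands for \<open>x \<otimes> t\<^sup>n\<close>, with \<open>n\<close> any integer.\<close>

datatype affine_basis = Loop sl2_basis int | Central

type_synonym affine_sl2 = "affine_basis \<Rightarrow>\<^sub>0 complex"

text \<open>
  \<open>[x \<otimes> t\<^sup>n, y \<otimes> t\<^sup>m] = [x,y] \<otimes> t\<^sup>n\<^sup>+\<^sup>m + n \<delta> \<kappa>\<^sub>0(x,y) K\<close>, where \<open>\<delta>\<close> is \<open>1\<close> if \<open>n + m = 0\<close> and
  \<open>0\<close> otherwise, and \<open>K\<close> is the central element.
\<close>

fun affine_basis_bracket :: "affine_basis \<Rightarrow> affine_basis \<Rightarrow> affine_sl2"
  where
    "affine_basis_bracket (Loop x n) (Loop y m) =
       linext (\<lambda>z. Poly_Mapping.single (Loop z (n + m)) 1) (sl2_bracket x y) +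
       Poly_Mapping.single Central (if n + m = 0 then of_int n * kappa0 x y else 0)"
  | "affine_basis_bracket Central _ = 0"
  | "affine_basis_bracket _ Central = 0"

definition affine_bracket :: "affine_sl2 \<Rightarrow> affine_sl2 \<Rightarrow> affine_sl2"
  where "affine_bracket X Y = linext (\<lambda>g. linext (affine_basis_bracket g) Y) X"

type_synonym 'm affine_action = "affine_sl2 \<Rightarrow> ('m \<Rightarrow>\<^sub>0 complex) \<Rightarrow> ('m \<Rightarrow>\<^sub>0 complex)"

definition affine_module :: "'m affine_action \<Rightarrow> bool"
  where "affine_module \<rho> \<longleftrightarrow>
    (\<forall>X. clin (\<rho> X)) \<and> (\<forall>v. clin (\<lambda>X. \<rho> X v)) \<and>
    (\<forall>X Y v. \<rho> (affine_bracket X Y) v = \<rho> X (\<rho> Y v) - \<rho> Y (\<rho> X v))"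

definition intertwining_operator ::
    "'m affine_action \<Rightarrow> 'n affine_action \<Rightarrow> (('m \<Rightarrow>\<^sub>0 complex) \<Rightarrow> ('n \<Rightarrow>\<^sub>0 complex)) \<Rightarrow> bool"
  where "intertwining_operator \<rho> \<sigma> S \<longleftrightarrow>
    affine_module \<rho> \<and> affine_module \<sigma> \<and> clin S \<and> (\<forall>X v. S (\<rho> X v) = \<sigma> X (S v))"

text \<open>
  Fields \<open>\<phi> x\<close> for \<open>x\<close> in the basis of \<open>sl\<^sub>2\<close> determine an action in which \<open>x \<otimes> t\<^sup>n\<close> acts as
  the coefficient of \<open>z\<^sup>-\<^sup>n\<^sup>-\<^sup>1\<close>; at level \<open>k\<close> the central element acts as \<open>k\<close>.
\<close>

fun affine_basis_action ::
    "complex \<Rightarrow> (sl2_basis \<Rightarrow> ('m \<Rightarrow>\<^sub>0 complex, 'm \<Rightarrow>\<^sub>0 complex) dist) \<Rightarrow>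
     affine_basis \<Rightarrow> ('m \<Rightarrow>\<^sub>0 complex) \<Rightarrow> ('m \<Rightarrow>\<^sub>0 complex)"
  where
    "affine_basis_action k \<phi> (Loop x n) v = \<phi> x (- n - 1) v"
  | "affine_basis_action k \<phi> Central v = cscale k v"

definition action_of_fields ::
    "complex \<Rightarrow> (sl2_basis \<Rightarrow> ('m \<Rightarrow>\<^sub>0 complex, 'm \<Rightarrow>\<^sub>0 complex) dist) \<Rightarrow> 'm affine_action"
  where "action_of_fields k \<phi> X v = linext (\<lambda>g. affine_basis_action k \<phi> g v) X"


section \<open>Wakimoto modules and the screening operator\<close>

type_synonym wakimoto_basis = "(weyl_var \<Rightarrow>\<^sub>0 nat) \<times> (nat \<Rightarrow>\<^sub>0 nat)"
type_synonym wakimoto_space = "wakimoto_basis \<Rightarrow>\<^sub>0 complex"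

definition a_field :: "(wakimoto_space, wakimoto_space) dist"
  where "a_field i = tensor_map (a_op (- i - 1)) id"

definition as_field :: "(wakimoto_space, wakimoto_space) dist"
  where "as_field i = tensor_map (as_op (- i)) id"

definition b_field :: "complex \<Rightarrow> complex \<Rightarrow> (wakimoto_space, wakimoto_space) dist"
  where "b_field \<kappa> \<nu> i = tensor_map id (b_op \<kappa> \<nu> (- i - 1))"

fun wakimoto_field ::
    "complex \<Rightarrow> complex \<Rightarrow> sl2_basis \<Rightarrow> (wakimoto_space, wakimoto_space) dist"
  where
    "wakimoto_field \<nu> k E = a_field"
  | "wakimoto_field \<nu> k H =
       dist_add (dist_scale (- 2) (normal_prod as_field a_field)) (b_field (k + 2) \<nu>)"
  | "wakimoto_field \<nu> k F =
       dist_add (dist_scale (- 1) (normal_prod as_field (normal_prod as_field a_field)))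
      (dist_add (dist_scale k (dist_deriv as_field))
                (dist_mult as_field (b_field (k + 2) \<nu>)))"

definition wakimoto :: "complex \<Rightarrow> complex \<Rightarrow> wakimoto_basis affine_action"
  where "wakimoto \<nu> k = action_of_fields k (wakimoto_field \<nu> k)"

text \<open>
  \<open>T\<close> from the Fock module of highest weight \<open>\<nu>\<close> to that of highest weight \<open>\<mu>\<close>.  Existence and
  uniqueness, hence the definedness of the description, is \<open>shift_op_unique\<close> below.
\<close>

definition is_shift_op ::
    "complex \<Rightarrow> complex \<Rightarrow> complex \<Rightarrow> (heis_fock \<Rightarrow> heis_fock) \<Rightarrow> bool"
  where "is_shift_op \<kappa> \<nu> \<mu> T \<longleftrightarrow>
    clin T \<and> T vac = vac \<and> (\<forall>n v. n \<noteq> 0 \<longrightarrow> T (b_op \<kappa> \<nu> n v) = b_op \<kappa> \<mu> n (T v))"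

definition shift_op :: "complex \<Rightarrow> complex \<Rightarrow> complex \<Rightarrow> heis_fock \<Rightarrow> heis_fock"
  where "shift_op \<kappa> \<nu> \<mu> = (THE T. is_shift_op \<kappa> \<nu> \<mu> T)"

text \<open>
  The coefficient of \<open>z\<^sup>i\<close> in \<open>(1/\<kappa>) \<Sum> (b\<^sub>n / n) z\<^sup>-\<^sup>n\<close> (with \<open>n = -i\<close>), the sum being over
  \<open>n < 0\<close> and over \<open>n > 0\<close>, respectively.
\<close>

definition vertex_exponent_neg :: "complex \<Rightarrow> (heis_fock, heis_fock) dist"
  where "vertex_exponent_neg \<kappa> =
    (\<lambda>i v. if - i < 0 then cscale (1 / \<kappa>) (cscale (1 / of_int (- i)) (b_op \<kappa> 0 (- i) v)) else 0)"

definition vertex_exponent_pos :: "complex \<Rightarrow> (heis_fock, heis_fock) dist"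
  where "vertex_exponent_pos \<kappa> =
    (\<lambda>i v. if - i > 0 then cscale (1 / \<kappa>) (cscale (1 / of_int (- i)) (b_op \<kappa> 0 (- i) v)) else 0)"

definition vertex_op :: "complex \<Rightarrow> (heis_fock, heis_fock) dist"
  where "vertex_op \<kappa> = (\<lambda>i v. shift_op \<kappa> 0 (- 2)
    (dist_mult (dist_exp (vertex_exponent_neg \<kappa>)) (dist_exp (vertex_exponent_pos \<kappa>)) i v))"

definition screening_field :: "complex \<Rightarrow> (wakimoto_space, wakimoto_space) dist"
  where "screening_field k = dist_mult a_field (\<lambda>i. tensor_map id (vertex_op (k + 2) i))"

definition screening_op :: "complex \<Rightarrow> wakimoto_space \<Rightarrow> wakimoto_space"
  where "screening_op k = dist_residue (screening_field k)"


section \<open>Adequacy of the Fock modules and of the shift operator\<close>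

lemma lookup_cscale [simp]: "Poly_Mapping.lookup (cscale c v) m = c * Poly_Mapping.lookup v m"
  by (simp add: cscale_def Poly_Mapping.map.rep_eq when_def)

lemma vector_space_cscale: "vector_space (cscale :: complex \<Rightarrow> ('m \<Rightarrow>\<^sub>0 complex) \<Rightarrow> _)"
  by unfold_locales (auto intro!: poly_mapping_eqI simp: lookup_add algebra_simps)

lemma clin_iff:
  "clin g \<longleftrightarrow> (\<forall>x y. g (x + y) = g x + g y) \<and> (\<forall>c x. g (cscale c x) = cscale c (g x))"
  by (auto simp: Vector_Spaces.linear_def module_hom_def module_hom_axioms_def
      vector_space_cscale module_iff_vector_space)

lemma cscale_add [simp]: "cscale c (x + y) = cscale c x + cscale c y"
  by (intro poly_mapping_eqI) (simp add: lookup_add algebra_simps)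

lemma cscale_add_left: "cscale (c + d) x = cscale c x + cscale d x"
  by (intro poly_mapping_eqI) (simp add: lookup_add algebra_simps)

lemma cscale_cscale [simp]: "cscale c (cscale d x) = cscale (c * d) x"
  by (intro poly_mapping_eqI) simp

lemma cscale_0 [simp]: "cscale 0 x = 0"
  by (intro poly_mapping_eqI) simp

lemma cscale_1 [simp]: "cscale 1 x = x"
  by (intro poly_mapping_eqI) simp

lemma cscale_zero [simp]: "cscale c 0 = 0"
  by (intro poly_mapping_eqI) simp

lemma cscale_uminus: "cscale c (- x) = - cscale c x"
  by (intro poly_mapping_eqI) simp

lemma cscale_single [simp]: "cscale c (Poly_Mapping.single m d) = Poly_Mapping.single m (c * d)"
  by (intro poly_mapping_eqI) (simp add: lookup_single when_def)

lemma cscale_sum: "cscale c (sum h S) = (\<Sum>m\<in>S. cscale c (h m))"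
  by (induction S rule: infinite_finite_induct) auto

lemma linext_superset:
  assumes "finite S" "Poly_Mapping.keys v \<subseteq> S"
  shows "linext g v = (\<Sum>m\<in>S. cscale (Poly_Mapping.lookup v m) (g m))"
  unfolding linext_def using assms
  by (intro sum.mono_neutral_left) (auto simp: in_keys_iff)

lemma clin_linext: "clin (linext g)"
  unfolding clin_iff
proof (intro conjI allI)
  fix x y :: "'a \<Rightarrow>\<^sub>0 complex"
  let ?S = "Poly_Mapping.keys x \<union> Poly_Mapping.keys y"
  show "linext g (x + y) = linext g x + linext g y"
    using keys_add[of x y]
    by (simp add: linext_superset[of ?S] lookup_add cscale_add_left sum.distrib)
next
  fix c and x :: "'a \<Rightarrow>\<^sub>0 complex"
  have "Poly_Mapping.keys (cscale c x) \<subseteq> Poly_Mapping.keys x"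
    by (auto simp: in_keys_iff)
  then show "linext g (cscale c x) = cscale c (linext g x)"
    by (simp add: linext_superset[of "Poly_Mapping.keys x"] cscale_sum)
qed

lemma linext_single [simp]: "linext g (Poly_Mapping.single m c) = cscale c (g m)"
  by (simp add: linext_def)

lemma linext_basis: "linext (\<lambda>m. Poly_Mapping.single m 1) v = v"
  by (intro poly_mapping_eqI)
    (auto simp: linext_def lookup_sum lookup_single when_def in_keys_iff)

lemma clin_sum: "clin g \<Longrightarrow> g (sum h S) = (\<Sum>m\<in>S. g (h m))"
proof (induction S rule: infinite_finite_induct)
  case (infinite S)
  then have "g (0 + 0) = g 0 + g 0" unfolding clin_iff by blast
  then show ?case using infinite by simp
next
  case empty
  then have "g (0 + 0) = g 0 + g 0" unfolding clin_iff by blast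
  then show ?case by simp
qed (auto simp: clin_iff)

lemma clin_eqI:
  assumes "clin g" "clin h" "\<And>m. g (Poly_Mapping.single m 1) = h (Poly_Mapping.single m 1)"
  shows "g v = h v"
proof -
  have *: "q v = linext (\<lambda>m. q (Poly_Mapping.single m 1)) v"
    if "clin q" for q :: "('a \<Rightarrow>\<^sub>0 complex) \<Rightarrow> ('b \<Rightarrow>\<^sub>0 complex)"
  proof -
    have "q v = q (\<Sum>m\<in>Poly_Mapping.keys v.
        cscale (Poly_Mapping.lookup v m) (Poly_Mapping.single m 1))"
      using linext_basis[of v] by (simp add: linext_def)
    also have "\<dots> = (\<Sum>m\<in>Poly_Mapping.keys v.
        q (cscale (Poly_Mapping.lookup v m) (Poly_Mapping.single m 1)))"
      by (rule clin_sum[OF that])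
    also have "\<dots> = linext (\<lambda>m. q (Poly_Mapping.single m 1)) v"
      using that unfolding clin_iff linext_def by metis
    finally show ?thesis .
  qed
  show ?thesis using *[OF assms(1)] *[OF assms(2)] assms(3) by simp
qed

lemma clin_var_deriv: "clin (var_deriv x)"
  unfolding var_deriv_def by (rule clin_linext)

lemma clin_var_mult: "clin (var_mult x)"
  by (auto simp: clin_iff var_mult_def cscale_def mult_map_scale_conv_mult algebra_simps)

lemma var_op_linear [simp]:
  "var_deriv x (u + v) = var_deriv x u + var_deriv x v"
  "var_deriv x (cscale c v) = cscale c (var_deriv x v)"
  "var_deriv x (- v) = - var_deriv x v"
  "var_mult x (u + v) = var_mult x u + var_mult x v"
  "var_mult x (cscale c v) = cscale c (var_mult x v)"
  "var_mult x (- v) = - var_mult x v"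
proof -
  have um: "- w = cscale (- 1) w" for w :: "'c fock"
    by (intro poly_mapping_eqI) simp
  show "var_deriv x (u + v) = var_deriv x u + var_deriv x v"
    and d: "var_deriv x (cscale c v) = cscale c (var_deriv x v)" for c
    using clin_var_deriv[of x] by (auto simp: clin_iff)
  show "var_mult x (u + v) = var_mult x u + var_mult x v"
    and m: "var_mult x (cscale c v) = cscale c (var_mult x v)" for c
    using clin_var_mult[of x] by (auto simp: clin_iff)
  show "var_deriv x (- v) = - var_deriv x v" "var_mult x (- v) = - var_mult x v"
    unfolding um by (rule d, rule m)
qed

lemma var_mult_single [simp]:
  "var_mult x (Poly_Mapping.single m c) = Poly_Mapping.single (Poly_Mapping.single x 1 + m) c"
  by (simp add: var_mult_def mult_single)

lemma var_deriv_single [simp]: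
  "var_deriv x (Poly_Mapping.single m c) =
    Poly_Mapping.single (m - Poly_Mapping.single x 1) (c * of_nat (Poly_Mapping.lookup m x))"
  by (simp add: var_deriv_def)

lemma var_mult_zero [simp]: "var_mult x 0 = 0"
  by (simp add: var_mult_def)

lemma var_mult_commute: "var_mult x (var_mult y v) = var_mult y (var_mult x v)"
  by (simp add: var_mult_def mult.left_commute)

lemma var_deriv_commute: "var_deriv x (var_deriv y v) = var_deriv y (var_deriv x v)"
proof (rule clin_eqI[where g = "\<lambda>v. var_deriv x (var_deriv y v)"
      and h = "\<lambda>v. var_deriv y (var_deriv x v)"])
  fix m :: "'a \<Rightarrow>\<^sub>0 nat"
  show "var_deriv x (var_deriv y (Poly_Mapping.single m 1)) =
        var_deriv y (var_deriv x (Poly_Mapping.single m 1))"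
    by (cases "x = y")
      (auto simp: lookup_minus lookup_single mult.commute
        diff_right_commute[of m "Poly_Mapping.single x (Suc 0)"])
qed (simp_all add: clin_iff)

lemma var_deriv_mult:
  "var_deriv x (var_mult y v) = var_mult y (var_deriv x v) + (if x = y then v else 0)"
proof (rule clin_eqI[where g = "\<lambda>v. var_deriv x (var_mult y v)"
      and h = "\<lambda>v. var_mult y (var_deriv x v) + (if x = y then v else 0)"])
  show "clin (\<lambda>v. var_mult y (var_deriv x v) + (if x = y then v else 0))"
    by (simp add: clin_iff algebra_simps)
next
  fix m :: "'a \<Rightarrow>\<^sub>0 nat"
  have eq: "Poly_Mapping.single y 1 + (m - Poly_Mapping.single x 1) =
      Poly_Mapping.single y 1 + m - Poly_Mapping.single x 1"
    if "x \<noteq> y \<or> Poly_Mapping.lookup m x \<noteq> 0"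
    using that by (intro poly_mapping_eqI) (auto simp: lookup_add lookup_minus lookup_single when_def)
  show "var_deriv x (var_mult y (Poly_Mapping.single m 1)) =
    var_mult y (var_deriv x (Poly_Mapping.single m 1)) +
      (if x = y then Poly_Mapping.single m 1 else 0)"
    using eq
    by (cases "x = y"; cases "Poly_Mapping.lookup m x = 0")
      (auto simp: lookup_add lookup_single add.commute[of "1 :: complex"] simp flip: single_add)
qed (simp_all add: clin_iff)

lemma var_deriv_vac [simp]: "var_deriv x vac = 0"
  using var_deriv_single[of x 0 1] by (simp add: vac_def del: var_deriv_single)

lemma fock_cyclic:
  assumes "P (vac :: 'x fock)" "\<And>u v. P u \<Longrightarrow> P v \<Longrightarrow> P (u + v)" "\<And>c v. P v \<Longrightarrow> P (cscale c v)"
    and "\<And>x v. P v \<Longrightarrow> P (var_mult x v)"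
  shows "P v"
proof -
  have mon: "P (Poly_Mapping.single m 1)" for m :: "'x \<Rightarrow>\<^sub>0 nat"
  proof (induction "\<Sum>x\<in>Poly_Mapping.keys m. Poly_Mapping.lookup m x" arbitrary: m)
    case 0
    then have "m = 0" by (intro poly_mapping_eqI) (auto simp: in_keys_iff)
    then show ?case using assms(1) by (simp add: vac_def)
  next
    case (Suc d)
    then obtain x where x: "x \<in> Poly_Mapping.keys m" by fastforce
    define m' where "m' = m - Poly_Mapping.single x 1"
    have m: "m = Poly_Mapping.single x 1 + m'"
      using x unfolding m'_def
      by (intro poly_mapping_eqI) (auto simp: lookup_add lookup_minus lookup_single when_def in_keys_iff)
    have lm: "Poly_Mapping.lookup m y = (if y = x then 1 else 0) + Poly_Mapping.lookup m' y" for y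
      by (subst m) (simp add: lookup_add lookup_single when_def)
    have sub: "Poly_Mapping.keys m' \<subseteq> Poly_Mapping.keys m"
      by (auto simp: in_keys_iff lm)
    have "(\<Sum>y\<in>Poly_Mapping.keys m. Poly_Mapping.lookup m y) =
        (\<Sum>y\<in>Poly_Mapping.keys m. if y = x then 1 else 0) +
        (\<Sum>y\<in>Poly_Mapping.keys m. Poly_Mapping.lookup m' y)"
      by (simp only: lm sum.distrib)
    moreover have "(\<Sum>y\<in>Poly_Mapping.keys m. Poly_Mapping.lookup m' y) =
        (\<Sum>y\<in>Poly_Mapping.keys m'. Poly_Mapping.lookup m' y)"
      using sub by (intro sum.mono_neutral_right) (auto simp: in_keys_iff)
    ultimately have "d = (\<Sum>y\<in>Poly_Mapping.keys m'. Poly_Mapping.lookup m' y)"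
      using Suc(2) x by simp
    then have "P (var_mult x (Poly_Mapping.single m' 1))"
      using Suc(1) assms(4) by blast
    then show ?case using m by simp
  qed
  have zero: "P 0" using assms(3)[OF assms(1), of 0] by simp
  have "P (\<Sum>m\<in>S. cscale (Poly_Mapping.lookup v m) (Poly_Mapping.single m 1))" for S
    by (induction S rule: infinite_finite_induct) (auto simp del: cscale_single intro: zero assms(2,3) mon)
  then show ?thesis using linext_basis[of v] unfolding linext_def by metis
qed

theorem weyl_fock_module:
  shows "a_op n (as_op m v) - as_op m (a_op n v) = (if n = - m then v else 0)"
    and "a_op n (a_op m v) = a_op m (a_op n v)"
    and "as_op n (as_op m v) = as_op m (as_op n v)"
    and "n \<ge> 0 \<Longrightarrow> a_op n vac = 0"
    and "n > 0 \<Longrightarrow> as_op n vac = 0"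
    and "\<lbrakk>P vac; \<And>u v. P u \<Longrightarrow> P v \<Longrightarrow> P (u + v); \<And>c v. P v \<Longrightarrow> P (cscale c v);
          \<And>n v. P v \<Longrightarrow> P (a_op n v); \<And>n v. P v \<Longrightarrow> P (as_op n v)\<rbrakk> \<Longrightarrow> P v"
proof -
  show "a_op n (as_op m v) - as_op m (a_op n v) = (if n = - m then v else 0)"
    by (auto simp: a_op_def as_op_def var_deriv_mult var_mult_commute
        var_deriv_commute[of "Vas _"] nat_eq_iff)
  show "a_op n (a_op m v) = a_op m (a_op n v)"
    using var_deriv_commute var_mult_commute by (auto simp: a_op_def var_deriv_mult)
  show "as_op n (as_op m v) = as_op m (as_op n v)"
    using var_deriv_commute var_mult_commute by (auto simp: as_op_def var_deriv_mult)
  show "n \<ge> 0 \<Longrightarrow> a_op n vac = 0" "n > 0 \<Longrightarrow> as_op n vac = 0"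
    by (simp_all add: a_op_def as_op_def)
  assume P: "P vac" "\<And>u v. P u \<Longrightarrow> P v \<Longrightarrow> P (u + v)" "\<And>c v. P v \<Longrightarrow> P (cscale c v)"
    "\<And>n v. P v \<Longrightarrow> P (a_op n v)" "\<And>n v. P v \<Longrightarrow> P (as_op n v)"
  have "P (var_mult x v)" if "P v" for x v
  proof (cases x)
    case (Va i)
    then show ?thesis using P(4)[OF that, of "- int i - 1"] by (simp add: a_op_def)
  next
    case (Vas i)
    then show ?thesis using P(5)[OF that, of "- int i"] by (simp add: as_op_def)
  qed
  with P(1-3) show "P v" by (rule fock_cyclic)
qed

theorem heis_fock_module:
  shows "b_op \<kappa> \<nu> n (b_op \<kappa> \<nu> m v) - b_op \<kappa> \<nu> m (b_op \<kappa> \<nu> n v) =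
      (if n = - m then cscale (2 * \<kappa> * of_int n) v else 0)"
    and "n > 0 \<Longrightarrow> b_op \<kappa> \<nu> n vac = 0"
    and "b_op \<kappa> \<nu> 0 vac = cscale \<nu> vac"
    and "\<lbrakk>P vac; \<And>u v. P u \<Longrightarrow> P v \<Longrightarrow> P (u + v); \<And>c v. P v \<Longrightarrow> P (cscale c v);
          \<And>n v. P v \<Longrightarrow> P (b_op \<kappa> \<nu> n v)\<rbrakk> \<Longrightarrow> P v"
proof -
  have mc: "var_mult x (var_mult y w) - var_mult y (var_mult x w) = 0"
    "var_deriv x (var_deriv y w) = var_deriv y (var_deriv x w)" for x y and w :: heis_fock
    using var_mult_commute var_deriv_commute by auto
  show "b_op \<kappa> \<nu> n (b_op \<kappa> \<nu> m v) - b_op \<kappa> \<nu> m (b_op \<kappa> \<nu> n v) =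
      (if n = - m then cscale (2 * \<kappa> * of_int n) v else 0)"
  proof -
    consider "n < 0" "m < 0" | "n > 0" "m > 0" | "n < 0" "m > 0" | "n > 0" "m < 0" | "n = 0" | "m = 0"
      by linarith
    then show ?thesis
    proof cases
      case 1 then show ?thesis by (auto simp: b_op_def mc)
    next
      case 2 then show ?thesis
        using mc(2)[of "nat (n - 1)" "nat (m - 1)" v]
        by (auto simp: b_op_def mult_ac)
    next
      case 3 then show ?thesis
        by (auto simp: b_op_def var_deriv_mult nat_eq_iff simp flip: cscale_uminus)
          (auto intro!: poly_mapping_eqI)
    next
      case 4 then show ?thesis
        by (auto simp: b_op_def var_deriv_mult nat_eq_iff)
    next
      case 5 then show ?thesis by (auto simp: b_op_def mult_ac)
    next
      case 6 then show ?thesis by (auto simp: b_op_def mult_ac)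
    qed
  qed
  show "n > 0 \<Longrightarrow> b_op \<kappa> \<nu> n vac = 0" "b_op \<kappa> \<nu> 0 vac = cscale \<nu> vac"
    by (simp_all add: b_op_def)
  assume P: "P vac" "\<And>u v. P u \<Longrightarrow> P v \<Longrightarrow> P (u + v)" "\<And>c v. P v \<Longrightarrow> P (cscale c v)"
    "\<And>n v. P v \<Longrightarrow> P (b_op \<kappa> \<nu> n v)"
  have "P (var_mult x v)" if "P v" for x v
    using P(4)[OF that, of "- int x - 1"] by (simp add: b_op_def)
  with P(1-3) show "P v" by (rule fock_cyclic)
qed

theorem shift_op_unique: "is_shift_op \<kappa> \<nu> \<mu> T \<longleftrightarrow> T = id"
proof
  show "is_shift_op \<kappa> \<nu> \<mu> T" if "T = id"
    using that by (simp add: is_shift_op_def b_op_def clin_iff)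
  show "T = id" if T: "is_shift_op \<kappa> \<nu> \<mu> T"
  proof
    fix v
    show "T v = id v"
    proof (rule fock_cyclic[where P = "\<lambda>v. T v = id v"])
      fix x v assume v: "T v = id v"
      have "T (b_op \<kappa> \<nu> (- int x - 1) v) = b_op \<kappa> \<mu> (- int x - 1) (T v)"
        using T unfolding is_shift_op_def by auto
      then show "T (var_mult x v) = id (var_mult x v)"
        using v by (simp add: b_op_def)
    qed (use T in \<open>auto simp: is_shift_op_def clin_iff\<close>)
  qed
qed

corollary shift_op_eq_id: "shift_op \<kappa> \<nu> \<mu> = id"
  by (simp add: shift_op_def shift_op_unique)

end

theory Submission
  imports Defs
begin

text \<open>
  All three currents are normally ordered products of free fields, so everything is a computation
  with commutators of modes.  The commutator of an operator with a normally ordered product obeys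
  the Leibniz rule (\<open>nop_leibniz\<close>).  In the result the index of a factor may be shifted by \<open>m\<close>
  against its ordering; restoring the ordering costs \<open>m\<close> times the commutator of the two factors
  (\<open>nop_shift_left\<close>).  Apart from the commutators of the free fields themselves, this is the only
  source of central terms.  For instance the modes of \<open>:a\<^sup>*a:\<close> with indices \<open>n\<close> and \<open>- n\<close> have
  commutator \<open>- n\<close>, so that \<open>[h\<^sub>n, h\<^sub>-\<^sub>n] = - 4 n + 2 (k + 2) n = 2 k n\<close>.

  The relations between \<open>e\<close>, \<open>h\<close> and \<open>f\<close> at level \<open>k\<close> follow in this way, except for
  \<open>[f\<^sub>n, f\<^sub>m] = 0\<close>.  That commutator \<open>X\<close> commutes with all free modes, hence it is determined by
  \<open>X |0>\<close>, which the annihilation modes kill.  On such a vector \<open>h\<^sub>0\<close> acts by the highest weight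
  \<open>\<nu>\<close>, whereas \<open>[h\<^sub>0, X] = - 4 X\<close> forces the weight \<open>\<nu> - 4\<close>; so \<open>X\<close> vanishes (\<open>f_f\<close>).

  The vertex operator enters through \<open>[b\<^sub>n, V(w)] = - 2 w\<^sup>n V(w)\<close> (\<open>b_vertex_op\<close>), which holds
  because \<open>b\<^sub>n\<close> has scalar commutators with the exponents.  Then \<open>e\<close> and \<open>h\<close> commute with the
  screening field as a whole; for \<open>h\<close> the weights \<open>2\<close> of \<open>a\<close> and \<open>- 2\<close> of \<open>V\<close> cancel.  For \<open>f\<close> the
  commutator is the total derivative \<open>(k + 2) \<partial>\<^sub>w (w\<^sup>m V(w))\<close>, whose residue is zero.
  Instead of differentiating \<open>V\<close>, the proof studies the difference of the two sides of this
  formula: it commutes with \<open>a\<close> and \<open>a\<^sup>*\<close>, behaves like \<open>V\<close> under \<open>b\<close>, and comparing its two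
  commutators with \<open>h\<^sub>r\<close> shows that it only depends on the total degree (\<open>defect_shift\<close>), so that
  \<open>f\<^sub>0\<close> alone has to be treated.  There the values on the vacuum are killed by all annihilation
  modes and have no vacuum coefficient, so they are zero (\<open>annihilated_zero\<close>,
  \<open>defect_zero_vac\<close>).
\<close>

section \<open>Linear maps between free vector spaces\<close>

lemma
  assumes "clin g"
  shows clin_add: "g (x + y) = g x + g y"
    and clin_scale: "g (cscale c x) = cscale c (g x)"
    and clin_zero: "g 0 = 0"
    and clin_minus: "g (- x) = - g x"
    and clin_diff: "g (x - y) = g x - g y"
proof -
  show a: "g (x + y) = g x + g y" and s: "g (cscale c x) = cscale c (g x)" for x y c
    using assms by (auto simp: clin_iff)
  show z: "g 0 = 0" using s[of 0 0] by simp
  show m: "g (- x) = - g x" for x using a[of x "- x"] z by (simp add: eq_neg_iff_add_eq_0 add.commute)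
  show "g (x - y) = g x - g y" using a[of x "- y"] m[of y] by simp
qed

text \<open>
  Equations between vectors are decided coefficientwise: after rewriting with these rules they are
  identities between complex numbers.
\<close>
lemmas vec_eq = poly_mapping_eq_iff fun_eq_iff lookup_add lookup_minus lookup_uminus

lemma clin_compose: "clin g \<Longrightarrow> clin h \<Longrightarrow> clin (\<lambda>v. g (h v))"
  by (auto simp: clin_iff)

lemma clin_plus: "clin g \<Longrightarrow> clin h \<Longrightarrow> clin (\<lambda>v. g v + h v)"
  by (auto simp: clin_iff algebra_simps)

lemma clin_sub: "clin g \<Longrightarrow> clin h \<Longrightarrow> clin (\<lambda>v. g v - h v)"
  by (auto simp: clin_iff vec_eq algebra_simps)

lemma clin_cscale: "clin g \<Longrightarrow> clin (\<lambda>v. cscale c (g v))"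
  by (auto simp: clin_iff mult.commute)

lemma clin_ident: "clin (\<lambda>v. v)"
  by (simp add: clin_iff)

lemma clin_zero_map: "clin (\<lambda>v. 0)"
  by (simp add: clin_iff)

lemma clin_if: "(b \<Longrightarrow> clin g) \<Longrightarrow> (\<not> b \<Longrightarrow> clin h) \<Longrightarrow> clin (\<lambda>v. if b then g v else h v)"
  by (cases b) simp_all

lemmas clin_intros = clin_plus clin_sub clin_cscale clin_ident clin_zero_map clin_if

lemma clin_basis_expansion:
  "clin g \<Longrightarrow> g v = linext (\<lambda>m. g (Poly_Mapping.single m 1)) v"
  by (rule clin_eqI) (auto intro: clin_linext)

lemma cscale_sum_left: "cscale (sum c S) v = (\<Sum>l\<in>S. cscale (c l) v)"
  by (induction S rule: infinite_finite_induct) (auto simp: cscale_add_left)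

lemma Sum_any_clin:
  assumes "clin g" "finite {l. h l \<noteq> 0}"
  shows "g (Sum_any h) = Sum_any (\<lambda>l. g (h l))"
proof -
  have "Sum_any (\<lambda>l. g (h l)) = (\<Sum>l\<in>{l. h l \<noteq> 0}. g (h l))"
    by (rule Sum_any.expand_superset[OF assms(2)]) (auto simp: clin_zero[OF assms(1)])
  then show ?thesis using clin_sum[OF assms(1)] by (simp add: Sum_any.expand_set)
qed

lemma clin_Sum_any:
  assumes "\<And>l. clin (g l)" "\<And>v. finite {l. g l v \<noteq> 0}"
  shows "clin (\<lambda>v. Sum_any (\<lambda>l. g l v))"
  unfolding clin_iff
proof (intro conjI allI)
  show "Sum_any (\<lambda>l. g l (x + y)) = Sum_any (\<lambda>l. g l x) + Sum_any (\<lambda>l. g l y)" for x y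
    by (simp add: clin_add[OF assms(1)] Sum_any.distrib assms(2))
  show "Sum_any (\<lambda>l. g l (cscale c x)) = cscale c (Sum_any (\<lambda>l. g l x))" for c x
    by (simp add: clin_scale[OF assms(1)] assms(2)
        Sum_any_clin[where g = "cscale c", OF clin_cscale[OF clin_ident]])
qed

text \<open>
  An infinite \<open>Sum_any\<close> is zero by convention, hence it satisfies \<open>P\<close> as well.
\<close>
lemma Sum_any_preserves:
  assumes "P 0" "\<And>x y. P x \<Longrightarrow> P y \<Longrightarrow> P (x + y)" "\<And>l. P (h l)"
  shows "P (Sum_any h)"
proof -
  have "P (\<Sum>l\<in>S. h l)" for S
    by (induction S rule: infinite_finite_induct) (use assms in auto)
  then show ?thesis by (simp add: Sum_any.expand_set)
qed

section \<open>Fields and their normally ordered products\<close>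

text \<open>
  \<open>P n\<close> plays the role of the mode with index \<open>n\<close>; truncation for large indices is what makes
  products of two fields summable on each vector.
\<close>
definition is_field :: "(int \<Rightarrow> ('m \<Rightarrow>\<^sub>0 complex) \<Rightarrow> ('n \<Rightarrow>\<^sub>0 complex)) \<Rightarrow> bool"
  where "is_field P \<longleftrightarrow> (\<forall>n. clin (P n)) \<and> (\<forall>v. \<exists>N. \<forall>n\<ge>N. P n v = 0)"

text \<open>
  Modes of the left factor with index at most \<open>0\<close> count as creation operators.  This is the
  convention of \<open>:a\<^sup>*(z) B(z):\<close>, where \<open>a\<^sup>*\<close> has weight \<open>0\<close>.  For commuting factors it is the
  plain product of fields.
\<close>
definition nop ::
  "(int \<Rightarrow> ('m \<Rightarrow>\<^sub>0 complex) \<Rightarrow> ('m \<Rightarrow>\<^sub>0 complex)) \<Rightarrow> (int \<Rightarrow> ('m \<Rightarrow>\<^sub>0 complex) \<Rightarrow> ('m \<Rightarrow>\<^sub>0 complex)) \<Rightarrow>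
   int \<Rightarrow> ('m \<Rightarrow>\<^sub>0 complex) \<Rightarrow> ('m \<Rightarrow>\<^sub>0 complex)"
  where "nop P Q n v = Sum_any (\<lambda>l. if l \<le> 0 then P l (Q (n - l) v) else Q (n - l) (P l v))"

lemma field_clin: "is_field P \<Longrightarrow> clin (P n)"
  by (simp add: is_field_def)

lemma field_truncated:
  assumes "is_field P"
  obtains N where "N > 0" "\<And>n. n \<ge> N \<Longrightarrow> P n v = 0"
proof -
  obtain N where "\<forall>n\<ge>N. P n v = 0" using assms unfolding is_field_def by blast
  then show ?thesis using that[of "max 1 N"] by simp
qed

lemma is_field_basis:
  assumes "\<And>n. clin (P n)" "\<And>m. \<exists>N. \<forall>n\<ge>N. P n (Poly_Mapping.single m 1) = 0"
  shows "is_field P"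
proof -
  obtain N where N: "P n (Poly_Mapping.single m 1) = 0" if "n \<ge> N m" for m n
    using assms(2) by metis
  have "\<exists>M. \<forall>n\<ge>M. P n v = 0" for v
  proof (intro exI allI impI)
    fix n assume n: "n \<ge> Max (insert 0 (N ` Poly_Mapping.keys v))"
    then have "n \<ge> N m" if "m \<in> Poly_Mapping.keys v" for m
      using that by simp
    then show "P n v = 0"
      by (subst clin_basis_expansion[OF assms(1)]) (simp add: linext_def N)
  qed
  then show ?thesis using assms(1) by (simp add: is_field_def)
qed

lemma finite_int_bounded:
  fixes S :: "int set"
  assumes "\<And>l. l \<in> S \<Longrightarrow> a \<le> l \<and> l \<le> b"
  shows "finite S"
  by (rule finite_subset[of _ "{a..b}"]) (use assms in auto)

lemma nop_finite:
  assumes "is_field P" "is_field Q"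
  shows "finite {l. (if l \<le> 0 then P l (Q (n - l) v) else Q (n - l) (P l v)) \<noteq> 0}"
proof -
  obtain M where M: "M > 0" "\<And>r. r \<ge> M \<Longrightarrow> P r v = 0" using field_truncated[OF assms(1)] by blast
  obtain N where N: "N > 0" "\<And>r. r \<ge> N \<Longrightarrow> Q r v = 0" using field_truncated[OF assms(2)] by blast
  show ?thesis
  proof (rule finite_int_bounded)
    fix l assume l: "l \<in> {l. (if l \<le> 0 then P l (Q (n - l) v) else Q (n - l) (P l v)) \<noteq> 0}"
    show "min 0 (n - N) \<le> l \<and> l \<le> M"
    proof (rule ccontr)
      assume "\<not> ?thesis"
      then consider "l < 0" "n - l \<ge> N" | "l \<ge> M" by linarith
      then show False
      proof cases
        case 1
        then show False using l N(2)[of "n - l"] by (simp add: clin_zero[OF field_clin[OF assms(1)]])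
      next
        case 2
        then show False
          using l M(1) M(2)[of l] by (simp add: clin_zero[OF field_clin[OF assms(2)]])
      qed
    qed
  qed
qed

lemma clin_nop:
  assumes "is_field P" "is_field Q"
  shows "clin (nop P Q n)"
proof -
  have "clin (\<lambda>v. if l \<le> 0 then P l (Q (n - l) v) else Q (n - l) (P l v))" for l
    by (intro clin_if clin_compose[OF field_clin[OF assms(1)] field_clin[OF assms(2)]]
        clin_compose[OF field_clin[OF assms(2)] field_clin[OF assms(1)]])
  from clin_Sum_any[OF this nop_finite[OF assms]] show ?thesis by (simp add: nop_def[abs_def])
qed

text \<open>
  For \<open>l \<le> 0\<close> the index \<open>n - l\<close> of the right factor is at least \<open>n\<close>.  For \<open>l > 0\<close> only
  finitely many \<open>P l v\<close> are nonzero, and one bound works for all of them.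
\<close>
lemma is_field_nop:
  assumes "is_field P" "is_field Q"
  shows "is_field (nop P Q)"
  unfolding is_field_def
proof (intro conjI allI)
  fix v
  obtain M where M: "M > 0" "\<And>r. r \<ge> M \<Longrightarrow> P r v = 0" using field_truncated[OF assms(1)] by blast
  obtain N where N: "N > 0" "\<And>r. r \<ge> N \<Longrightarrow> Q r v = 0" using field_truncated[OF assms(2)] by blast
  have "\<exists>K. \<forall>r\<ge>K. Q r w = 0" for w using assms(2) by (simp add: is_field_def)
  then have "\<forall>l. \<exists>N. \<forall>r\<ge>N. Q r (P l v) = 0" by blast
  then obtain K where K: "\<And>l r. r \<ge> K l \<Longrightarrow> Q r (P l v) = 0" by (auto dest!: choice)
  define L where "L = Max (insert N ((\<lambda>l. K l + l) ` {0..M}))"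
  have L: "L \<ge> N" "\<And>l. l \<in> {0..M} \<Longrightarrow> L \<ge> K l + l"
    unfolding L_def by (rule Max_ge; blast intro: finite_insert[THEN iffD2] finite_imageI)+
  show "\<exists>L. \<forall>n\<ge>L. nop P Q n v = 0"
  proof (intro exI allI impI)
    fix n assume n: "n \<ge> L"
    have "(if l \<le> 0 then P l (Q (n - l) v) else Q (n - l) (P l v)) = 0" for l
    proof -
      consider "l \<le> 0" | "0 < l" "l \<le> M" | "l > M" by linarith
      then show ?thesis
      proof cases
        case 1
        then show ?thesis
          using L(1) n N(2)[of "n - l"] by (simp add: clin_zero[OF field_clin[OF assms(1)]])
      next
        case 2
        then show ?thesis using L(2)[of l] n K[of l "n - l"] by simp
      next
        case 3
        then show ?thesis
          using M(1) M(2)[of l] by (simp add: clin_zero[OF field_clin[OF assms(2)]])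
      qed
    qed
    then show "nop P Q n v = 0" by (simp add: nop_def)
  qed
qed (rule clin_nop[OF assms])

lemma is_field_delta: "is_field (\<lambda>n v. if n = a then cscale c v else 0)"
  unfolding is_field_def
proof (intro conjI allI)
  show "\<exists>N. \<forall>n\<ge>N. (if n = a then cscale c v else 0) = 0" for v :: "'a \<Rightarrow>\<^sub>0 complex"
    by (rule exI[of _ "a + 1"]) auto
qed (intro clin_intros)

lemma is_field_shift: "is_field P \<Longrightarrow> is_field (\<lambda>n. P (n + m))"
  unfolding is_field_def
proof (elim conjE, intro conjI allI)
  fix v assume "\<forall>v. \<exists>N. \<forall>n\<ge>N. P n v = 0"
  then obtain N where "\<forall>n\<ge>N. P n v = 0" by blast
  then show "\<exists>N. \<forall>n\<ge>N. P (n + m) v = 0" by (intro exI[of _ "N - m"]) auto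
qed simp

lemma is_field_scale: "is_field P \<Longrightarrow> is_field (\<lambda>n v. cscale c (P n v))"
  unfolding is_field_def
proof (elim conjE, intro conjI allI clin_cscale)
  fix v assume "\<forall>v. \<exists>N. \<forall>n\<ge>N. P n v = 0"
  then obtain N where "\<forall>n\<ge>N. P n v = 0" by blast
  then show "\<exists>N. \<forall>n\<ge>N. cscale c (P n v) = 0" by (intro exI[of _ N]) auto
qed simp

lemma is_field_zero: "is_field (\<lambda>n v. 0)"
  by (simp add: is_field_def clin_zero_map)

lemma nop_zero_left:
  assumes "is_field Q"
  shows "nop (\<lambda>n v. 0) Q n v = 0"
  by (simp add: nop_def clin_zero[OF field_clin[OF assms]] cong: if_cong)

lemma nop_zero_right:
  assumes "is_field P"
  shows "nop P (\<lambda>n v. 0) n v = 0"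
  by (simp add: nop_def clin_zero[OF field_clin[OF assms]] cong: if_cong)

lemma nop_scale_left:
  assumes "is_field P" "is_field Q"
  shows "nop (\<lambda>n v. cscale c (P n v)) Q n v = cscale c (nop P Q n v)"
  unfolding nop_def
  by (subst Sum_any_clin[OF clin_cscale[OF clin_ident] nop_finite[OF assms]])
    (intro Sum_any.cong, simp add: clin_scale[OF field_clin[OF assms(2)]])

lemma nop_scale_right:
  assumes "is_field P" "is_field Q"
  shows "nop P (\<lambda>n v. cscale c (Q n v)) n v = cscale c (nop P Q n v)"
  unfolding nop_def
  by (subst Sum_any_clin[OF clin_cscale[OF clin_ident] nop_finite[OF assms]])
    (intro Sum_any.cong, simp add: clin_scale[OF field_clin[OF assms(1)]])

lemma nop_delta_left:
  assumes "is_field Q"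
  shows "nop (\<lambda>n v. if n = a then cscale c v else 0) Q n v = cscale c (Q (n - a) v)"
proof -
  have "nop (\<lambda>n v. if n = a then cscale c v else 0) Q n v =
      Sum_any (\<lambda>l. if l = a then cscale c (Q (n - a) v) else 0)"
    unfolding nop_def by (intro Sum_any.cong)
      (auto simp: field_clin[OF assms, THEN clin_scale] field_clin[OF assms, THEN clin_zero])
  then show ?thesis by simp
qed

lemma nop_delta_right:
  assumes "is_field P"
  shows "nop P (\<lambda>n v. if n = a then cscale c v else 0) n v = cscale c (P (n - a) v)"
proof -
  have "nop P (\<lambda>n v. if n = a then cscale c v else 0) n v =
      Sum_any (\<lambda>l. if l = n - a then cscale c (P (n - a) v) else 0)"
    unfolding nop_def by (intro Sum_any.cong)
      (auto simp: field_clin[OF assms, THEN clin_scale] field_clin[OF assms, THEN clin_zero])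
  then show ?thesis by simp
qed

lemma nop_shift_right: "nop P (\<lambda>r. Q (r + m)) n v = nop P Q (n + m) v"
  unfolding nop_def by (rule Sum_any.cong) (simp only: diff_add_eq)

lemma Sum_any_shift: "Sum_any (\<lambda>l::int. g (l + m)) = Sum_any g"
proof -
  have "bij (\<lambda>l::int. l + m)" by (rule bij_plus_right)
  from Sum_any.reindex_cong[OF this refl, of g] show ?thesis by (simp add: o_def)
qed

text \<open>
  Shifting the index of the left factor by \<open>m\<close> moves the point at which the order of the factors
  changes; the \<open>m\<close> terms between the two points are reordered, each at the cost of the same
  commutator \<open>Z\<close>.  The central terms of the affine algebra arise here.
\<close>
lemma nop_shift_left:
  assumes P: "is_field P" and Q: "is_field Q"
    and comm: "\<And>l r. P l (Q r v) = Q r (P l v) + Z (l + r)"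
  shows "nop (\<lambda>l. P (l + m)) Q n v = nop P Q (n + m) v + cscale (of_int m) (Z (n + m))"
proof -
  \<comment> \<open>The number of times, with sign, that the two factors with left index \<open>l\<close> are interchanged.\<close>
  define jump :: "int \<Rightarrow> complex" where
    "jump l = (if 0 < l \<and> l \<le> m then 1 else 0) - (if m < l \<and> l \<le> 0 then 1 else 0)" for l
  let ?t = "\<lambda>l. if l \<le> 0 then P l (Q (n + m - l) v) else Q (n + m - l) (P l v)"
  let ?A = "{- \<bar>m\<bar>..\<bar>m\<bar>}"
  have fin: "finite {l. jump l \<noteq> 0}"
    by (rule finite_int_bounded[of _ "- \<bar>m\<bar>" "\<bar>m\<bar>"]) (auto simp: jump_def split: if_splits)
  have "nop (\<lambda>l. P (l + m)) Q n v =
      Sum_any (\<lambda>l. (\<lambda>l. if l \<le> m then P l (Q (n + m - l) v) else Q (n + m - l) (P l v)) (l + m))"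
    unfolding nop_def by (rule Sum_any.cong) (simp only: add_diff_cancel_right add_le_same_cancel2)
  also have "\<dots> = Sum_any (\<lambda>l. if l \<le> m then P l (Q (n + m - l) v) else Q (n + m - l) (P l v))"
    by (rule Sum_any_shift)
  also have "\<dots> = Sum_any (\<lambda>l. ?t l + cscale (jump l) (Z (n + m)))"
  proof (intro Sum_any.cong)
    fix l
    show "(if l \<le> m then P l (Q (n + m - l) v) else Q (n + m - l) (P l v)) =
        ?t l + cscale (jump l) (Z (n + m))"
      using comm[of l "n + m - l"] by (auto simp: jump_def vec_eq)
  qed
  also have "\<dots> = Sum_any ?t + Sum_any (\<lambda>l. cscale (jump l) (Z (n + m)))"
    by (intro Sum_any.distrib nop_finite P Q)
      (rule finite_subset[OF _ fin], auto)
  finally have shifted: "nop (\<lambda>l. P (l + m)) Q n v =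
      nop P Q (n + m) v + Sum_any (\<lambda>l. cscale (jump l) (Z (n + m)))"
    by (simp only: nop_def)
  have "(\<Sum>l\<in>?A. if 0 < l \<and> l \<le> m then 1 else 0 :: complex) = (\<Sum>l\<in>{0<..m}. 1)"
    by (rule sum.mono_neutral_cong_right) auto
  moreover have "(\<Sum>l\<in>?A. if m < l \<and> l \<le> 0 then 1 else 0 :: complex) = (\<Sum>l\<in>{m<..0}. 1)"
    by (rule sum.mono_neutral_cong_right) auto
  ultimately have "(\<Sum>l\<in>?A. jump l) = of_nat (card {0<..m}) - of_nat (card {m<..0})"
    unfolding jump_def sum_subtractf by simp
  then have total: "(\<Sum>l\<in>?A. jump l) = of_int m"
    by (cases "m \<ge> 0") auto
  have "Sum_any (\<lambda>l. cscale (jump l) (Z (n + m))) = (\<Sum>l\<in>?A. cscale (jump l) (Z (n + m)))"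
    by (rule Sum_any.expand_superset) (auto simp: jump_def split: if_splits)
  then show ?thesis
    by (simp only: shifted total cscale_sum_left[symmetric])
qed

text \<open>
  The operators \<open>X\<close> and \<open>Y\<close>, and likewise \<open>Q\<close> and \<open>Q2\<close>, are the same current acting on different
  modules, as is needed when the product or \<open>X\<close> contains the vertex operator, which maps one Fock
  module to another.
\<close>
lemma nop_leibniz_twisted:
  assumes P: "is_field P" and Q: "is_field Q" and Q2: "is_field Q2" and P': "is_field P'" and Q': "is_field Q'"
    and X: "clin X" and Y: "clin Y"
    and XP: "\<And>l u. X (P l u) = P l (X u) + P' l u"
    and YP: "\<And>l u. Y (P l u) = P l (Y u) + P' l u"
    and XQ: "\<And>r u. X (Q r u) = Q2 r (Y u) + Q' r u"
    and eq: "\<And>r l u. Q2 r (P' l u) = Q r (P' l u)"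
  shows "X (nop P Q n v) = nop P Q2 n (Y v) + nop P' Q n v + nop P Q' n v"
proof -
  have "X (nop P Q n v) = Sum_any (\<lambda>l. X (if l \<le> 0 then P l (Q (n - l) v) else Q (n - l) (P l v)))"
    unfolding nop_def by (rule Sum_any_clin[OF X nop_finite[OF P Q]])
  also have "\<dots> = Sum_any (\<lambda>l.
       ((if l \<le> 0 then P l (Q2 (n - l) (Y v)) else Q2 (n - l) (P l (Y v))) +
        (if l \<le> 0 then P' l (Q (n - l) v) else Q (n - l) (P' l v))) +
        (if l \<le> 0 then P l (Q' (n - l) v) else Q' (n - l) (P l v)))"
    by (intro Sum_any.cong)
      (simp add: XP YP XQ eq clin_add[OF field_clin[OF P]] clin_add[OF field_clin[OF Q2]] add_ac)
  also have "\<dots> = nop P Q2 n (Y v) + nop P' Q n v + nop P Q' n v"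
  proof -
    have fin: "finite {l. g l + h l \<noteq> 0}" if "finite {l. g l \<noteq> 0}" "finite {l. h l \<noteq> 0}"
      for g h :: "int \<Rightarrow> 'a \<Rightarrow>\<^sub>0 complex"
      by (rule finite_subset[OF _ finite_UnI[OF that]]) auto
    show ?thesis
      unfolding nop_def
      by (simp only: Sum_any.distrib fin nop_finite[OF P Q2] nop_finite[OF P' Q] nop_finite[OF P Q'])
  qed
  finally show ?thesis .
qed

lemma nop_leibniz:
  assumes "is_field P" "is_field Q" "is_field P'" "is_field Q'" "clin X" "clin Y"
    and "\<And>l u. X (P l u) = P l (X u) + P' l u" "\<And>l u. Y (P l u) = P l (Y u) + P' l u"
    and "\<And>r u. X (Q r u) = Q r (Y u) + Q' r u"
  shows "X (nop P Q n v) = nop P Q n (Y v) + nop P' Q n v + nop P Q' n v"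
  by (rule nop_leibniz_twisted) (use assms in auto)

section \<open>Operators on a tensor product\<close>

text \<open>
  A functional is a linear map into the free vector space on one element.
\<close>
lemma functional_eqI:
  fixes g h :: "('m \<Rightarrow>\<^sub>0 complex) \<Rightarrow> complex"
  assumes "\<And>x y. g (x + y) = g x + g y" "\<And>c x. g (cscale c x) = c * g x"
    and "\<And>x y. h (x + y) = h x + h y" "\<And>c x. h (cscale c x) = c * h x"
    and "\<And>m. g (Poly_Mapping.single m 1) = h (Poly_Mapping.single m 1)"
  shows "g v = h v"
proof -
  have "Poly_Mapping.single () (g v) = Poly_Mapping.single () (h v)"
    by (rule clin_eqI[where g = "\<lambda>v. Poly_Mapping.single () (g v)"
          and h = "\<lambda>v. Poly_Mapping.single () (h v)"])
      (simp_all add: clin_iff assms single_add)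
  then have "Poly_Mapping.lookup (Poly_Mapping.single () (g v)) () =
      Poly_Mapping.lookup (Poly_Mapping.single () (h v)) ()" by simp
  then show ?thesis by simp
qed

lemma lookup_linext:
  "Poly_Mapping.lookup (linext g v) k =
    (\<Sum>m\<in>Poly_Mapping.keys v. Poly_Mapping.lookup v m * Poly_Mapping.lookup (g m) k)"
  by (simp add: linext_def lookup_sum)

lemma lookup_tensor:
  "Poly_Mapping.lookup (tensor x y) (m, p) = Poly_Mapping.lookup x m * Poly_Mapping.lookup y p"
proof -
  have inner: "Poly_Mapping.lookup (linext (\<lambda>p. Poly_Mapping.single (m', p) 1) y) (m, p) =
      (if m' = m then Poly_Mapping.lookup y p else 0)" for m'
    by (auto simp: lookup_linext lookup_single when_def in_keys_iff if_distrib cong: if_cong)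
  show ?thesis by (auto simp: tensor_def lookup_linext[where v = x] inner in_keys_iff if_distrib cong: if_cong)
qed

lemma clin_tensor_left: "clin (\<lambda>x. tensor x y)"
  by (auto simp: clin_iff vec_eq lookup_tensor algebra_simps)

lemma clin_tensor_right: "clin (tensor x)"
  by (auto simp: clin_iff vec_eq lookup_tensor algebra_simps)

lemmas tensor_linear = clin_add[OF clin_tensor_left] clin_add[OF clin_tensor_right]
  clin_scale[OF clin_tensor_left] clin_scale[OF clin_tensor_right]
  clin_zero[OF clin_tensor_left] clin_zero[OF clin_tensor_right]

lemma tensor_single: "tensor (Poly_Mapping.single m c) (Poly_Mapping.single p d) =
    Poly_Mapping.single (m, p) (c * d)"
  by (simp add: tensor_def)

text \<open>
  Basis vectors are pure tensors, so every operator identity on the Wakimoto space can be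
  verified on pure tensors, where it becomes an identity on one of the two factors.
\<close>
lemma tensor_eqI:
  assumes "clin g" "clin h" "\<And>x y. g (tensor x y) = h (tensor x y)"
  shows "g v = h v"
proof (rule clin_eqI[OF assms(1,2)])
  fix mp :: "'a \<times> 'b"
  show "g (Poly_Mapping.single mp 1) = h (Poly_Mapping.single mp 1)"
    using assms(3)[of "Poly_Mapping.single (fst mp) 1" "Poly_Mapping.single (snd mp) 1"]
    by (simp add: tensor_single)
qed

lemma clin_tensor_map: "clin (tensor_map A B)"
  unfolding tensor_map_def by (rule clin_linext)

lemma tensor_map_tensor:
  assumes "clin A" "clin B"
  shows "tensor_map A B (tensor x y) = tensor (A x) (B y)"
proof (rule clin_eqI[where g = "\<lambda>x. tensor_map A B (tensor x y)" and h = "\<lambda>x. tensor (A x) (B y)"])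
  show "clin (\<lambda>x. tensor_map A B (tensor x y))"
    by (rule clin_compose[OF clin_tensor_map clin_tensor_left])
  show "clin (\<lambda>x. tensor (A x) (B y))"
    by (rule clin_compose[OF clin_tensor_left assms(1)])
  fix m
  show "tensor_map A B (tensor (Poly_Mapping.single m 1) y) = tensor (A (Poly_Mapping.single m 1)) (B y)"
  proof (rule clin_eqI[where g = "\<lambda>y. tensor_map A B (tensor (Poly_Mapping.single m 1) y)"
        and h = "\<lambda>y. tensor (A (Poly_Mapping.single m 1)) (B y)"])
    show "clin (\<lambda>y. tensor_map A B (tensor (Poly_Mapping.single m 1) y))"
      by (rule clin_compose[OF clin_tensor_map clin_tensor_right])
    show "clin (\<lambda>y. tensor (A (Poly_Mapping.single m 1)) (B y))"
      by (rule clin_compose[OF clin_tensor_right assms(2)])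
  qed (simp add: tensor_single tensor_map_def)
qed

lemma clin_id: "clin id"
  by (simp add: clin_iff)

lemma is_field_tensor_left:
  assumes "is_field A"
  shows "is_field (\<lambda>n. tensor_map (A n) id)"
proof (rule is_field_basis[OF clin_tensor_map])
  fix mp :: "'a \<times> 'c"
  obtain N where N: "\<And>n. n \<ge> N \<Longrightarrow> A n (Poly_Mapping.single (fst mp) 1) = 0"
    using field_truncated[OF assms] by blast
  have "tensor_map (A n) id (Poly_Mapping.single mp 1) = 0" if "n \<ge> N" for n
    using N[OF that] by (cases mp) (simp add: tensor_map_def tensor_linear)
  then show "\<exists>N. \<forall>n\<ge>N. tensor_map (A n) id (Poly_Mapping.single mp 1) = 0" by blast
qed

lemma is_field_tensor_right:
  assumes "is_field B"
  shows "is_field (\<lambda>n. tensor_map id (B n))"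
proof (rule is_field_basis[OF clin_tensor_map])
  fix mp :: "'c \<times> 'a"
  obtain N where N: "\<And>n. n \<ge> N \<Longrightarrow> B n (Poly_Mapping.single (snd mp) 1) = 0"
    using field_truncated[OF assms] by blast
  have "tensor_map id (B n) (Poly_Mapping.single mp 1) = 0" if "n \<ge> N" for n
    using N[OF that] by (cases mp) (simp add: tensor_map_def tensor_linear)
  then show "\<exists>N. \<forall>n\<ge>N. tensor_map id (B n) (Poly_Mapping.single mp 1) = 0" by blast
qed

section \<open>The modes on the Wakimoto space\<close>

definition a_mode :: "int \<Rightarrow> wakimoto_space \<Rightarrow> wakimoto_space"
  where "a_mode n = tensor_map (a_op n) id"

definition as_mode :: "int \<Rightarrow> wakimoto_space \<Rightarrow> wakimoto_space"
  where "as_mode n = tensor_map (as_op n) id"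

definition b_mode :: "complex \<Rightarrow> complex \<Rightarrow> int \<Rightarrow> wakimoto_space \<Rightarrow> wakimoto_space"
  where "b_mode \<kappa> \<nu> n = tensor_map id (b_op \<kappa> \<nu> n)"

abbreviation wvac :: wakimoto_space
  where "wvac \<equiv> tensor vac vac"

lemma clin_a_op: "clin (a_op n)"
  unfolding a_op_def[abs_def] by (intro clin_if clin_var_mult clin_var_deriv)

lemma clin_as_op: "clin (as_op n)"
  unfolding as_op_def[abs_def]
  by (intro clin_if clin_var_mult) (simp add: clin_iff cscale_uminus)

lemma clin_b_op: "clin (b_op \<kappa> \<nu> n)"
  unfolding b_op_def[abs_def]
  by (intro clin_if clin_var_mult clin_cscale clin_var_deriv clin_ident)

text \<open>
  A monomial contains finitely many variables, so annihilation operators of large index kill it.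
\<close>
lemma monomial_bounded:
  assumes "inj f"
  shows "\<exists>N. \<forall>i\<ge>N. Poly_Mapping.lookup (m :: 'x \<Rightarrow>\<^sub>0 nat) (f (i :: nat)) = 0"
proof -
  have "finite (f -` Poly_Mapping.keys m)"
    by (rule finite_vimageI[OF finite_keys assms])
  then obtain N where N: "\<forall>i\<in>f -` Poly_Mapping.keys m. i \<le> N"
    unfolding finite_nat_set_iff_bounded_le by (elim exE)
  have "Poly_Mapping.lookup m (f i) = 0" if "i \<ge> Suc N" for i
  proof (rule ccontr)
    assume "Poly_Mapping.lookup m (f i) \<noteq> 0"
    then have "i \<le> N" using N by (simp add: in_keys_iff)
    then show False using that by simp
  qed
  then show ?thesis by blast
qed

lemma is_field_a_op: "is_field a_op"
proof (rule is_field_basis[OF clin_a_op])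
  fix m :: "weyl_var \<Rightarrow>\<^sub>0 nat"
  obtain N where N: "\<And>i. i \<ge> N \<Longrightarrow> Poly_Mapping.lookup m (Vas i) = 0"
    using monomial_bounded[of Vas m] by (auto simp: inj_def)
  show "\<exists>N. \<forall>n\<ge>N. a_op n (Poly_Mapping.single m 1) = 0"
    by (rule exI[of _ "int N"]) (use N in \<open>auto simp: a_op_def le_nat_iff\<close>)
qed

lemma is_field_as_op: "is_field as_op"
proof (rule is_field_basis[OF clin_as_op])
  fix m :: "weyl_var \<Rightarrow>\<^sub>0 nat"
  obtain N where N: "\<And>i. i \<ge> N \<Longrightarrow> Poly_Mapping.lookup m (Va i) = 0"
    using monomial_bounded[of Va m] by (auto simp: inj_def)
  show "\<exists>N. \<forall>n\<ge>N. as_op n (Poly_Mapping.single m 1) = 0"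
    by (rule exI[of _ "int N + 1"]) (use N in \<open>auto simp: as_op_def le_nat_iff\<close>)
qed

lemma is_field_b_op: "is_field (b_op \<kappa> \<nu>)"
proof (rule is_field_basis[OF clin_b_op])
  fix m :: "nat \<Rightarrow>\<^sub>0 nat"
  obtain N where N: "\<And>i. i \<ge> N \<Longrightarrow> Poly_Mapping.lookup m i = 0"
    using monomial_bounded[of id m] by (auto simp: inj_def)
  show "\<exists>N. \<forall>n\<ge>N. b_op \<kappa> \<nu> n (Poly_Mapping.single m 1) = 0"
    by (rule exI[of _ "int N + 1"]) (use N in \<open>auto simp: b_op_def le_nat_iff\<close>)
qed

lemma is_field_a: "is_field a_mode"
  unfolding a_mode_def[abs_def] by (rule is_field_tensor_left[OF is_field_a_op])

lemma is_field_as: "is_field as_mode"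
  unfolding as_mode_def[abs_def] by (rule is_field_tensor_left[OF is_field_as_op])

lemma is_field_b: "is_field (b_mode \<kappa> \<nu>)"
  unfolding b_mode_def[abs_def] by (rule is_field_tensor_right[OF is_field_b_op])

lemmas clin_modes = field_clin[OF is_field_a] field_clin[OF is_field_as] field_clin[OF is_field_b]

lemma mode_tensor:
  "a_mode n (tensor x y) = tensor (a_op n x) y"
  "as_mode n (tensor x y) = tensor (as_op n x) y"
  "b_mode \<kappa> \<nu> n (tensor x y) = tensor x (b_op \<kappa> \<nu> n y)"
  by (simp_all add: a_mode_def as_mode_def b_mode_def tensor_map_tensor clin_a_op clin_as_op clin_b_op clin_id)

lemma a_as_mode: "a_mode n (as_mode m v) = as_mode m (a_mode n v) + (if m = - n then v else 0)"
proof (rule tensor_eqI[where g = "\<lambda>v. a_mode n (as_mode m v)"])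
  show "clin (\<lambda>v. a_mode n (as_mode m v))" "clin (\<lambda>v. as_mode m (a_mode n v) + (if m = - n then v else 0))"
    by (intro clin_intros clin_compose[OF clin_modes(1,2)] clin_compose[OF clin_modes(2,1)])+
  fix x :: weyl_fock and y :: heis_fock
  have "a_op n (as_op m x) = as_op m (a_op n x) + (if m = - n then x else 0)"
    using weyl_fock_module(1)[of n m x] by (auto simp: algebra_simps)
  then show "a_mode n (as_mode m (tensor x y)) =
      as_mode m (a_mode n (tensor x y)) + (if m = - n then tensor x y else 0)"
    by (auto simp: mode_tensor tensor_linear)
qed

lemma a_a_mode: "a_mode n (a_mode m v) = a_mode m (a_mode n v)"
proof (rule tensor_eqI[OF clin_compose[OF clin_modes(1,1)] clin_compose[OF clin_modes(1,1)]])
  show "a_mode n (a_mode m (tensor x y)) = a_mode m (a_mode n (tensor x y))" for x y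
    unfolding mode_tensor by (subst weyl_fock_module(2)) (rule refl)
qed

lemma as_as_mode: "as_mode n (as_mode m v) = as_mode m (as_mode n v)"
proof (rule tensor_eqI[OF clin_compose[OF clin_modes(2,2)] clin_compose[OF clin_modes(2,2)]])
  show "as_mode n (as_mode m (tensor x y)) = as_mode m (as_mode n (tensor x y))" for x y
    unfolding mode_tensor by (subst weyl_fock_module(3)) (rule refl)
qed

lemma tensor_map_right_commute:
  assumes "clin B"
  shows "tensor_map id B (a_mode n v) = a_mode n (tensor_map id B v)"
    and "tensor_map id B (as_mode n v) = as_mode n (tensor_map id B v)"
proof -
  show "tensor_map id B (a_mode n v) = a_mode n (tensor_map id B v)"
    by (rule tensor_eqI[OF clin_compose[OF clin_tensor_map clin_modes(1)]
          clin_compose[OF clin_modes(1) clin_tensor_map]])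
      (simp add: mode_tensor tensor_map_tensor[OF clin_id assms])
  show "tensor_map id B (as_mode n v) = as_mode n (tensor_map id B v)"
    by (rule tensor_eqI[OF clin_compose[OF clin_tensor_map clin_modes(2)]
          clin_compose[OF clin_modes(2) clin_tensor_map]])
      (simp add: mode_tensor tensor_map_tensor[OF clin_id assms])
qed

lemmas b_a_mode = tensor_map_right_commute(1)[OF clin_b_op, folded b_mode_def]
lemmas b_as_mode = tensor_map_right_commute(2)[OF clin_b_op, folded b_mode_def]

lemma b_b_mode: "b_mode \<kappa> \<nu> n (b_mode \<kappa> \<nu> m v) =
    b_mode \<kappa> \<nu> m (b_mode \<kappa> \<nu> n v) + (if m = - n then cscale (2 * \<kappa> * of_int n) v else 0)"
proof (rule tensor_eqI[where g = "\<lambda>v. b_mode \<kappa> \<nu> n (b_mode \<kappa> \<nu> m v)"])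
  show "clin (\<lambda>v. b_mode \<kappa> \<nu> n (b_mode \<kappa> \<nu> m v))"
    "clin (\<lambda>v. b_mode \<kappa> \<nu> m (b_mode \<kappa> \<nu> n v) + (if m = - n then cscale (2 * \<kappa> * of_int n) v else 0))"
    by (intro clin_intros clin_compose[OF clin_modes(3,3)])+
  fix x :: weyl_fock and y :: heis_fock
  have "b_op \<kappa> \<nu> n (b_op \<kappa> \<nu> m y) =
      b_op \<kappa> \<nu> m (b_op \<kappa> \<nu> n y) + (if m = - n then cscale (2 * \<kappa> * of_int n) y else 0)"
    using heis_fock_module(1)[of \<kappa> \<nu> n m y] by (auto simp: algebra_simps)
  then show "b_mode \<kappa> \<nu> n (b_mode \<kappa> \<nu> m (tensor x y)) = b_mode \<kappa> \<nu> m (b_mode \<kappa> \<nu> n (tensor x y)) +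
      (if m = - n then cscale (2 * \<kappa> * of_int n) (tensor x y) else 0)"
    by (auto simp: mode_tensor tensor_linear)
qed

lemma mode_vac:
  "n \<ge> 0 \<Longrightarrow> a_mode n wvac = 0" "n > 0 \<Longrightarrow> as_mode n wvac = 0"
  "n > 0 \<Longrightarrow> b_mode \<kappa> \<nu> n wvac = 0" "b_mode \<kappa> \<nu> 0 v = cscale \<nu> v"
proof -
  show "n \<ge> 0 \<Longrightarrow> a_mode n wvac = 0" "n > 0 \<Longrightarrow> as_mode n wvac = 0"
    "n > 0 \<Longrightarrow> b_mode \<kappa> \<nu> n wvac = 0"
    by (simp_all add: mode_tensor weyl_fock_module(4,5) heis_fock_module(2) tensor_linear)
  show "b_mode \<kappa> \<nu> 0 v = cscale \<nu> v"
    by (rule tensor_eqI[where g = "b_mode \<kappa> \<nu> 0"])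
      (auto simp: clin_modes mode_tensor b_op_def tensor_linear intro: clin_intros)
qed

text \<open>
  Cyclicity of the two Fock modules reaches all pure tensors from the vacuum.
\<close>
lemma wakimoto_induct:
  assumes vac: "P wvac" and add: "\<And>u v. P u \<Longrightarrow> P v \<Longrightarrow> P (u + v)"
    and scale: "\<And>c v. P v \<Longrightarrow> P (cscale c v)"
    and a: "\<And>n v. P v \<Longrightarrow> P (a_mode n v)" and as: "\<And>n v. P v \<Longrightarrow> P (as_mode n v)"
    and b: "\<And>n v. n < 0 \<Longrightarrow> P v \<Longrightarrow> P (b_mode \<kappa> \<nu> n v)"
  shows "P (v :: wakimoto_space)"
proof -
  have "P (tensor vac y)" for y
  proof (rule fock_cyclic[where P = "\<lambda>y. P (tensor vac y)"])
    fix i y assume "P (tensor vac y)"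
    from b[OF _ this, of "- int i - 1"] show "P (tensor vac (var_mult i y))"
      by (simp add: mode_tensor b_op_def)
  qed (auto simp: tensor_linear intro: vac add scale)
  then have T: "P (tensor x y)" for x y
  proof (rule weyl_fock_module(6)[where P = "\<lambda>x. P (tensor x y)"])
    fix n x assume "P (tensor x y)"
    from a[OF this, of n] as[OF this, of n]
    show "P (tensor (a_op n x) y)" "P (tensor (as_op n x) y)" by (simp_all add: mode_tensor)
  qed (auto simp: tensor_linear intro: add scale)
  have basis: "P (Poly_Mapping.single mp 1)" for mp
    using T[of "Poly_Mapping.single (fst mp) 1" "Poly_Mapping.single (snd mp) 1"]
    by (simp add: tensor_single)
  have zero: "P 0" using scale[OF vac, of 0] by simp
  have "P (\<Sum>m\<in>S. cscale (Poly_Mapping.lookup v m) (Poly_Mapping.single m 1))" for S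
    by (induction S rule: infinite_finite_induct) (auto simp del: cscale_single intro: zero add scale basis)
  then have "P (linext (\<lambda>m. Poly_Mapping.single m 1) v)" unfolding linext_def .
  then show ?thesis by (simp only: linext_basis)
qed

lemma lookup_var_deriv_single:
  "Poly_Mapping.lookup (var_deriv x (Poly_Mapping.single n c)) m =
    (if n = m + Poly_Mapping.single x 1 then of_nat (Poly_Mapping.lookup m x + 1) * c else 0)"
proof (cases "Poly_Mapping.lookup n x = 0")
  case True
  then have "n \<noteq> m + Poly_Mapping.single x 1" by (auto simp: lookup_add)
  then show ?thesis using True by simp
next
  case False
  then have "n - Poly_Mapping.single x 1 = m \<longleftrightarrow> n = m + Poly_Mapping.single x 1"
    by (auto simp: vec_eq lookup_single when_def)
  then show ?thesis by (auto simp: lookup_single when_def lookup_add mult.commute)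
qed

lemma lookup_tensor_deriv:
  "Poly_Mapping.lookup (tensor_map (var_deriv x) id v) (m, p) =
    of_nat (Poly_Mapping.lookup m x + 1) * Poly_Mapping.lookup v (m + Poly_Mapping.single x 1, p)"
  "Poly_Mapping.lookup (tensor_map id (var_deriv y) v') (m', p') =
    of_nat (Poly_Mapping.lookup p' y + 1) * Poly_Mapping.lookup v' (m', p' + Poly_Mapping.single y 1)"
proof -
  show "Poly_Mapping.lookup (tensor_map (var_deriv x) id v) (m, p) =
    of_nat (Poly_Mapping.lookup m x + 1) * Poly_Mapping.lookup v (m + Poly_Mapping.single x 1, p)"
  proof (rule functional_eqI[where g = "\<lambda>v. Poly_Mapping.lookup (tensor_map (var_deriv x) id v) (m, p)"
        and v = v])
    fix mp
    show "Poly_Mapping.lookup (tensor_map (var_deriv x) id (Poly_Mapping.single mp 1)) (m, p) =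
      of_nat (Poly_Mapping.lookup m x + 1) *
        Poly_Mapping.lookup (Poly_Mapping.single mp 1) (m + Poly_Mapping.single x 1, p)"
      by (cases mp) (simp add: tensor_map_def lookup_tensor lookup_var_deriv_single
          lookup_single when_def del: var_deriv_single)
  qed (simp_all add: clin_add[OF clin_tensor_map] clin_scale[OF clin_tensor_map] lookup_add algebra_simps)
  show "Poly_Mapping.lookup (tensor_map id (var_deriv y) v') (m', p') =
    of_nat (Poly_Mapping.lookup p' y + 1) * Poly_Mapping.lookup v' (m', p' + Poly_Mapping.single y 1)"
  proof (rule functional_eqI[where g = "\<lambda>v. Poly_Mapping.lookup (tensor_map id (var_deriv y) v) (m', p')"
        and v = v'])
    fix mp
    show "Poly_Mapping.lookup (tensor_map id (var_deriv y) (Poly_Mapping.single mp 1)) (m', p') =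
      of_nat (Poly_Mapping.lookup p' y + 1) *
        Poly_Mapping.lookup (Poly_Mapping.single mp 1) (m', p' + Poly_Mapping.single y 1)"
      by (cases mp) (simp add: tensor_map_def lookup_tensor lookup_var_deriv_single
          lookup_single when_def del: var_deriv_single)
  qed (simp_all add: clin_add[OF clin_tensor_map] clin_scale[OF clin_tensor_map] lookup_add algebra_simps)
qed

lemma mode_deriv:
  "a_mode (int i) v = tensor_map (var_deriv (Vas i)) id v"
  "as_mode (int i + 1) v = - tensor_map (var_deriv (Va i)) id v"
  "b_mode \<kappa> \<nu> (int i + 1) v = cscale (2 * \<kappa> * of_int (int i + 1)) (tensor_map id (var_deriv i) v)"
proof -
  show "a_mode (int i) v = tensor_map (var_deriv (Vas i)) id v"
    by (simp add: a_mode_def a_op_def[abs_def])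
  have m: "clin (\<lambda>v. - h v)" if "clin h" for h :: "wakimoto_space \<Rightarrow> wakimoto_space"
    using that by (simp add: clin_iff cscale_uminus)
  have neg: "tensor (- x) y = - tensor x y" for x :: weyl_fock and y :: heis_fock
    by (rule clin_minus[OF clin_tensor_left])
  show "as_mode (int i + 1) v = - tensor_map (var_deriv (Va i)) id v"
    by (rule tensor_eqI[OF clin_modes(2) m[OF clin_tensor_map]])
      (simp add: mode_tensor tensor_map_tensor clin_var_deriv clin_id as_op_def neg)
  show "b_mode \<kappa> \<nu> (int i + 1) v = cscale (2 * \<kappa> * of_int (int i + 1)) (tensor_map id (var_deriv i) v)"
    by (rule tensor_eqI[OF clin_modes(3) clin_cscale[OF clin_tensor_map]])
      (simp add: mode_tensor tensor_map_tensor clin_var_deriv clin_id b_op_def tensor_linear)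
qed

text \<open>
  Annihilation modes are nonzero multiples of the partial derivatives (for \<open>b\<close> this is where
  \<open>\<kappa> \<noteq> 0\<close> enters), and a polynomial with vanishing derivatives and constant term is zero.
\<close>
lemma annihilated_zero:
  assumes \<kappa>: "\<kappa> \<noteq> 0"
    and a: "\<And>n. n \<ge> 0 \<Longrightarrow> a_mode n u = 0" and as: "\<And>n. n > 0 \<Longrightarrow> as_mode n u = 0"
    and b: "\<And>n. n > 0 \<Longrightarrow> b_mode \<kappa> \<nu> n u = 0"
    and vac: "Poly_Mapping.lookup u (0, 0) = 0"
  shows "u = 0"
proof -
  have weyl: "tensor_map (var_deriv x) id u = 0" for x
  proof (cases x)
    case (Va i)
    then show ?thesis using as[of "int i + 1"] mode_deriv(2)[of i u] by simp
  next
    case (Vas i)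
    then show ?thesis using a[of "int i"] mode_deriv(1)[of i u] by simp
  qed
  have heis: "tensor_map id (var_deriv i) u = 0" for i
  proof -
    have "cscale (1 / (2 * \<kappa> * of_int (int i + 1)))
        (cscale (2 * \<kappa> * of_int (int i + 1)) (tensor_map id (var_deriv i) u)) = 0"
      using b[of "int i + 1"] mode_deriv(3)[of \<kappa> \<nu> i u] by simp
    moreover have "1 / (2 * \<kappa> * of_int (int i + 1)) * (2 * \<kappa> * of_int (int i + 1)) = 1"
      using \<kappa> of_nat_neq_0[of i, where 'a = complex] by (simp add: add.commute)
    ultimately show ?thesis by (simp only: cscale_cscale cscale_1)
  qed
  have split: "(m - Poly_Mapping.single x 1) + Poly_Mapping.single x 1 = m"
    if "x \<in> Poly_Mapping.keys m" for m :: "'x \<Rightarrow>\<^sub>0 nat" and x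
    using that by (auto simp: vec_eq lookup_single when_def in_keys_iff)
  have "Poly_Mapping.lookup u (m, p) = 0" for m p
  proof -
    consider "Poly_Mapping.keys m \<noteq> {}" | "Poly_Mapping.keys p \<noteq> {}" | "m = 0" "p = 0"
      unfolding keys_eq_empty by blast
    then show ?thesis
    proof cases
      case 1
      then obtain x where x: "x \<in> Poly_Mapping.keys m" by blast
      show ?thesis
        using lookup_tensor_deriv(1)[of x u "m - Poly_Mapping.single x 1" p]
        unfolding split[OF x] weyl by (simp flip: of_nat_Suc del: of_nat_Suc)
    next
      case 2
      then obtain i where i: "i \<in> Poly_Mapping.keys p" by blast
      show ?thesis
        using lookup_tensor_deriv(2)[of i u m "p - Poly_Mapping.single i 1"]
        unfolding split[OF i] heis by (simp flip: of_nat_Suc del: of_nat_Suc)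
    next
      case 3
      then show ?thesis using vac by simp
    qed
  qed
  then show ?thesis by (intro poly_mapping_eqI) auto
qed

lemma lookup_var_mult_zero: "Poly_Mapping.lookup (var_mult x v) 0 = 0"
proof (rule functional_eqI[where g = "\<lambda>v. Poly_Mapping.lookup (var_mult x v) 0" and h = "\<lambda>v. 0" and v = v])
  fix m :: "'a \<Rightarrow>\<^sub>0 nat"
  have "Poly_Mapping.single x 1 + m \<noteq> 0" by (auto simp: vec_eq lookup_single when_def)
  then show "Poly_Mapping.lookup (var_mult x (Poly_Mapping.single m 1)) 0 = 0"
    by (simp add: lookup_single when_def)
qed (simp_all add: lookup_add)

text \<open>
  Creation modes multiply by a variable.
\<close>
lemma vac_coeff_creation:
  "n < 0 \<Longrightarrow> Poly_Mapping.lookup (a_mode n v) (0, 0) = 0"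
  "n \<le> 0 \<Longrightarrow> Poly_Mapping.lookup (as_mode n v) (0, 0) = 0"
  "n < 0 \<Longrightarrow> Poly_Mapping.lookup (b_mode \<kappa> \<nu> n v) (0, 0) = 0"
proof -
  have reduce: "Poly_Mapping.lookup (g v) (0, 0) = 0"
    if "clin g" "\<And>x y. Poly_Mapping.lookup (g (tensor x y)) (0, 0) = 0"
    for g :: "wakimoto_space \<Rightarrow> wakimoto_space"
  proof (rule functional_eqI[where g = "\<lambda>v. Poly_Mapping.lookup (g v) (0, 0)" and h = "\<lambda>v. 0" and v = v])
    fix mp
    show "Poly_Mapping.lookup (g (Poly_Mapping.single mp 1)) (0, 0) = 0"
      using that(2)[of "Poly_Mapping.single (fst mp) 1" "Poly_Mapping.single (snd mp) 1"]
      by (simp add: tensor_single)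
  qed (simp_all add: clin_add[OF that(1)] clin_scale[OF that(1)] lookup_add)
  show "Poly_Mapping.lookup (a_mode n v) (0, 0) = 0" if "n < 0"
    by (rule reduce[OF clin_modes(1)])
      (use that in \<open>simp add: mode_tensor lookup_tensor a_op_def lookup_var_mult_zero\<close>)
  show "Poly_Mapping.lookup (as_mode n v) (0, 0) = 0" if "n \<le> 0"
    by (rule reduce[OF clin_modes(2)])
      (use that in \<open>simp add: mode_tensor lookup_tensor as_op_def lookup_var_mult_zero\<close>)
  show "Poly_Mapping.lookup (b_mode \<kappa> \<nu> n v) (0, 0) = 0" if "n < 0"
    by (rule reduce[OF clin_modes(3)])
      (use that in \<open>simp add: mode_tensor lookup_tensor b_op_def lookup_var_mult_zero\<close>)
qed

section \<open>Exponentials of one-sided distributions\<close>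

lemma Sum_any_Suc:
  assumes "h 0 = 0"
  shows "Sum_any h = Sum_any (\<lambda>j. h (Suc j))"
proof -
  have "{j. h j \<noteq> 0} = Suc ` {j. h (Suc j) \<noteq> 0}"
  proof (intro set_eqI iffI)
    fix j assume "j \<in> {j. h j \<noteq> 0}"
    then show "j \<in> Suc ` {j. h (Suc j) \<noteq> 0}" using assms by (cases j) auto
  qed auto
  then show ?thesis by (simp add: Sum_any.expand_set sum.reindex)
qed

text \<open>
  A distribution with only positive (\<open>s = 1\<close>) or only negative (\<open>s = - 1\<close>) powers of the variable.
  Its powers move away from degree \<open>0\<close>, so each coefficient of its exponential is a finite sum.
\<close>
locale one_sided =
  fixes A :: "('m \<Rightarrow>\<^sub>0 complex, 'm \<Rightarrow>\<^sub>0 complex) dist" and s :: int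
  assumes sign: "s = 1 \<or> s = - 1"
    and lin: "clin (A i)"
    and supp: "s * i \<le> 0 \<Longrightarrow> A i v = 0"
begin

lemma power_supp: "s * i < int j \<Longrightarrow> dist_power A j i v = 0"
proof (induction j arbitrary: i v)
  case 0
  then show ?case using sign by (auto simp: dist_one_def)
next
  case (Suc j)
  have "A l (dist_power A j (i - l) v) = 0" for l
  proof (cases "s * l \<le> 0")
    case False
    then have "s * (i - l) < int j" using Suc.prems by (simp add: right_diff_distrib)
    then show ?thesis using Suc.IH clin_zero[OF lin] by simp
  qed (simp add: supp)
  then show ?case by (simp add: dist_mult_def)
qed

lemma power_finite: "finite {l. A l (dist_power A j (i - l) v) \<noteq> 0}"
proof (rule finite_int_bounded)
  fix l assume "l \<in> {l. A l (dist_power A j (i - l) v) \<noteq> 0}"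
  then have nz: "A l (dist_power A j (i - l) v) \<noteq> 0" by simp
  then have "\<not> s * l \<le> 0" using supp by blast
  moreover have "\<not> s * (i - l) < int j"
  proof
    assume "s * (i - l) < int j"
    from power_supp[OF this, of v] show False using nz clin_zero[OF lin, of l] by simp
  qed
  ultimately show "- \<bar>i\<bar> \<le> l \<and> l \<le> \<bar>i\<bar>" using sign by auto
qed

lemma clin_power: "clin (dist_power A j i)"
proof (induction j arbitrary: i)
  case 0
  then show ?case by (simp add: dist_one_def[abs_def] clin_iff)
next
  case (Suc j)
  have "clin (\<lambda>v. A l (dist_power A j (i - l) v))" for l
    by (rule clin_compose[OF lin Suc])
  from clin_Sum_any[OF this power_finite] show ?case by (simp add: dist_mult_def[abs_def])
qed

lemma exp_finite: "finite {j. cscale (1 / fact j) (dist_power A j i v) \<noteq> 0}"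
proof (rule finite_subset[of _ "{..nat (s * i)}"])
  show "{j. cscale (1 / fact j) (dist_power A j i v) \<noteq> 0} \<subseteq> {..nat (s * i)}"
  proof (intro subsetI, rule ccontr)
    fix j assume j: "j \<in> {j. cscale (1 / fact j) (dist_power A j i v) \<noteq> 0}" "j \<notin> {..nat (s * i)}"
    then have "s * i < int j" by auto
    from power_supp[OF this, of v] show False using j(1) by simp
  qed
qed simp

lemma clin_exp: "clin (dist_exp A i)"
proof -
  have "clin (\<lambda>v. cscale (1 / fact j) (dist_power A j i v))" for j
    by (rule clin_cscale[OF clin_power])
  from clin_Sum_any[OF this exp_finite] show ?thesis by (simp add: dist_exp_def[abs_def])
qed

lemma exp_supp: "s * i < 0 \<Longrightarrow> dist_exp A i v = 0"
  by (simp add: dist_exp_def power_supp)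

text \<open>
  A scalar commutator makes \<open>X\<close> act on powers as a derivation \<open>A\<^sup>j \<mapsto> j c z\<^sup>n A\<^sup>j\<^sup>-\<^sup>1\<close>.  For
  \<open>j = 0\<close> the second term is zero whatever \<open>j - 1\<close> denotes.
\<close>
lemma power_commutator:
  assumes X: "clin X" and XA: "\<And>i v. X (A i v) = A i (X v) + (if i = n then cscale c v else 0)"
  shows "X (dist_power A j i v) =
    dist_power A j i (X v) + cscale (of_nat j * c) (dist_power A (j - 1) (i - n) v)"
proof (induction j arbitrary: i v)
  case 0
  then show ?case by (simp add: dist_one_def clin_zero[OF X])
next
  case (Suc j)
  have "X (dist_power A (Suc j) i v) = Sum_any (\<lambda>l. X (A l (dist_power A j (i - l) v)))"
    by (simp add: dist_mult_def Sum_any_clin[OF X power_finite])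
  also have "\<dots> = Sum_any (\<lambda>l. (A l (dist_power A j (i - l) (X v)) +
      cscale (of_nat j * c) (A l (dist_power A (j - 1) (i - n - l) v))) +
      (if l = n then cscale c (dist_power A j (i - n) v) else 0))"
  proof (rule Sum_any.cong)
    fix l
    have "dist_power A (j - 1) (i - l - n) v = dist_power A (j - 1) (i - n - l) v"
      by (rule arg_cong[of _ _ "\<lambda>r. dist_power A (j - 1) r v"]) simp
    then show "X (A l (dist_power A j (i - l) v)) = (A l (dist_power A j (i - l) (X v)) +
      cscale (of_nat j * c) (A l (dist_power A (j - 1) (i - n - l) v))) +
      (if l = n then cscale c (dist_power A j (i - n) v) else 0)"
      by (simp add: XA Suc.IH clin_add[OF lin] clin_scale[OF lin])
  qed
  also have "\<dots> = Sum_any (\<lambda>l. A l (dist_power A j (i - l) (X v))) +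
      Sum_any (\<lambda>l. cscale (of_nat j * c) (A l (dist_power A (j - 1) (i - n - l) v))) +
      Sum_any (\<lambda>l. if l = n then cscale c (dist_power A j (i - n) v) else 0)"
  proof -
    have fin2: "finite {l. cscale (of_nat j * c) (A l (dist_power A (j - 1) (i - n - l) v)) \<noteq> 0}"
      by (rule finite_subset[OF _ power_finite[of "j - 1" "i - n" v]]) auto
    have fin12: "finite {l. A l (dist_power A j (i - l) (X v)) +
        cscale (of_nat j * c) (A l (dist_power A (j - 1) (i - n - l) v)) \<noteq> 0}"
      by (rule finite_subset[OF _ finite_UnI[OF power_finite[of j i "X v"] fin2]]) auto
    have fin3: "finite {l. (if l = n then cscale c (dist_power A j (i - n) v) else 0) \<noteq> 0}"
      by (rule finite_subset[of _ "{n}"]) auto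
    show ?thesis by (simp only: Sum_any.distrib power_finite fin2 fin12 fin3)
  qed
  also have "Sum_any (\<lambda>l. cscale (of_nat j * c) (A l (dist_power A (j - 1) (i - n - l) v))) =
      cscale (of_nat j * c) (dist_power A j (i - n) v)"
  proof (cases j)
    case (Suc m)
    then show ?thesis
      by (simp add: dist_mult_def Sum_any_clin[OF clin_cscale[OF clin_ident] power_finite])
  qed simp
  also have "Sum_any (\<lambda>l. if l = n then cscale c (dist_power A j (i - n) v) else 0) =
      cscale c (dist_power A j (i - n) v)" by simp
  finally show ?case by (simp add: dist_mult_def vec_eq algebra_simps)
qed

text \<open>
  The usual \<open>[X, exp A] = [X, A] exp A\<close> for a scalar commutator.
\<close>
lemma exp_commutator:
  assumes X: "clin X" and XA: "\<And>i v. X (A i v) = A i (X v) + (if i = n then cscale c v else 0)"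
  shows "X (dist_exp A i v) = dist_exp A i (X v) + cscale c (dist_exp A (i - n) v)"
proof -
  let ?h = "\<lambda>j. cscale (1 / fact j * (of_nat j * c)) (dist_power A (j - 1) (i - n) v)"
  have h: "?h (Suc j) = cscale c (cscale (1 / fact j) (dist_power A j (i - n) v))" for j
  proof -
    have "1 / fact (Suc j) * (of_nat (Suc j) * c) = c * (1 / fact j :: complex)"
      using of_nat_neq_0[of j, where 'a = complex] by (simp add: divide_simps del: of_nat_Suc)
    then show ?thesis by (simp only: cscale_cscale diff_Suc_1)
  qed
  have "finite {j. ?h j \<noteq> 0}"
  proof (rule finite_subset[of _ "insert 0 (Suc ` {j. cscale (1 / fact j) (dist_power A j (i - n) v) \<noteq> 0})"])
    show "{j. ?h j \<noteq> 0} \<subseteq> insert 0 (Suc ` {j. cscale (1 / fact j) (dist_power A j (i - n) v) \<noteq> 0})"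
    proof
      fix j assume j: "j \<in> {j. ?h j \<noteq> 0}"
      show "j \<in> insert 0 (Suc ` {j. cscale (1 / fact j) (dist_power A j (i - n) v) \<noteq> 0})"
      proof (cases j)
        case (Suc m)
        then have "cscale c (cscale (1 / fact m) (dist_power A m (i - n) v)) \<noteq> 0"
          using j h[of m] by auto
        then have "cscale (1 / fact m) (dist_power A m (i - n) v) \<noteq> 0"
          using cscale_zero by metis
        then show ?thesis using Suc by blast
      qed simp
    qed
  qed (simp add: exp_finite)
  then have "X (dist_exp A i v) = Sum_any (\<lambda>j. cscale (1 / fact j) (dist_power A j i (X v))) + Sum_any ?h"
    using Sum_any.distrib[OF exp_finite[of i "X v"], of ?h]
    by (simp add: dist_exp_def Sum_any_clin[OF X exp_finite] clin_scale[OF X] power_commutator[OF X XA])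
  also have "Sum_any ?h = Sum_any (\<lambda>j. cscale c (cscale (1 / fact j) (dist_power A j (i - n) v)))"
    by (subst Sum_any_Suc) (simp_all only: h of_nat_0 mult_zero_left mult_zero_right cscale_0)
  also have "\<dots> = cscale c (dist_exp A (i - n) v)"
    unfolding dist_exp_def by (rule Sum_any_clin[OF clin_cscale[OF clin_ident] exp_finite, symmetric])
  finally show ?thesis by (simp add: dist_exp_def)
qed

end

section \<open>The vertex operator\<close>

lemma vertex_exponent_neg: "one_sided (vertex_exponent_neg \<kappa>) 1"
proof (rule one_sided.intro)
  show "clin (vertex_exponent_neg \<kappa> i)" for i
    unfolding vertex_exponent_neg_def by (intro clin_if clin_cscale clin_b_op clin_zero_map)
qed (auto simp: vertex_exponent_neg_def)

lemma vertex_exponent_pos: "one_sided (vertex_exponent_pos \<kappa>) (- 1)"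
proof (rule one_sided.intro)
  show "clin (vertex_exponent_pos \<kappa> i)" for i
    unfolding vertex_exponent_pos_def by (intro clin_if clin_cscale clin_b_op clin_zero_map)
qed (auto simp: vertex_exponent_pos_def)

text \<open>
  The factor \<open>1 / (- \<kappa> n)\<close> of \<open>b\<^sub>-\<^sub>n\<close> in the exponent times the commutator \<open>2 \<kappa> n\<close> of the
  Heisenberg algebra is \<open>- 2\<close>.  Each \<open>b\<^sub>n\<close> with \<open>n \<noteq> 0\<close> sees exactly one of the two
  exponents.
\<close>
lemma b_vertex_exponent:
  assumes "\<kappa> \<noteq> 0"
  shows "b_op \<kappa> 0 n (vertex_exponent_neg \<kappa> i v) = vertex_exponent_neg \<kappa> i (b_op \<kappa> 0 n v) +
      (if i = n then cscale (if n > 0 then - 2 else 0) v else 0)"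
    and "b_op \<kappa> 0 n (vertex_exponent_pos \<kappa> i v) = vertex_exponent_pos \<kappa> i (b_op \<kappa> 0 n v) +
      (if i = n then cscale (if n < 0 then - 2 else 0) v else 0)"
proof -
  have comm: "cscale (1 / \<kappa>) (cscale (1 / of_int (- i)) (b_op \<kappa> 0 n (b_op \<kappa> 0 (- i) v))) =
      cscale (1 / \<kappa>) (cscale (1 / of_int (- i)) (b_op \<kappa> 0 (- i) (b_op \<kappa> 0 n v))) +
      (if i = n then cscale (- 2) v else 0)" if "i \<noteq> 0"
  proof -
    have "b_op \<kappa> 0 n (b_op \<kappa> 0 (- i) v) = b_op \<kappa> 0 (- i) (b_op \<kappa> 0 n v) +
        (if i = n then cscale (2 * \<kappa> * of_int n) v else 0)"
      using heis_fock_module(1)[of \<kappa> 0 n "- i" v] by (auto simp: algebra_simps)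
    then show ?thesis using that assms by auto
  qed
  show "b_op \<kappa> 0 n (vertex_exponent_neg \<kappa> i v) = vertex_exponent_neg \<kappa> i (b_op \<kappa> 0 n v) +
      (if i = n then cscale (if n > 0 then - 2 else 0) v else 0)"
    using comm by (auto simp: vertex_exponent_neg_def clin_scale[OF clin_b_op] clin_zero[OF clin_b_op])
  show "b_op \<kappa> 0 n (vertex_exponent_pos \<kappa> i v) = vertex_exponent_pos \<kappa> i (b_op \<kappa> 0 n v) +
      (if i = n then cscale (if n < 0 then - 2 else 0) v else 0)"
    using comm by (auto simp: vertex_exponent_pos_def clin_scale[OF clin_b_op] clin_zero[OF clin_b_op])
qed

lemmas exp_neg_lin = one_sided.clin_exp[OF vertex_exponent_neg]
lemmas exp_pos_lin = one_sided.clin_exp[OF vertex_exponent_pos]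

lemma b_vertex_exp:
  assumes "\<kappa> \<noteq> 0"
  shows "b_op \<kappa> 0 n (dist_exp (vertex_exponent_neg \<kappa>) i v) =
      dist_exp (vertex_exponent_neg \<kappa>) i (b_op \<kappa> 0 n v) +
      cscale (if n > 0 then - 2 else 0) (dist_exp (vertex_exponent_neg \<kappa>) (i - n) v)"
    and "b_op \<kappa> 0 n (dist_exp (vertex_exponent_pos \<kappa>) i v) =
      dist_exp (vertex_exponent_pos \<kappa>) i (b_op \<kappa> 0 n v) +
      cscale (if n < 0 then - 2 else 0) (dist_exp (vertex_exponent_pos \<kappa>) (i - n) v)"
  by (rule one_sided.exp_commutator[OF vertex_exponent_neg clin_b_op b_vertex_exponent(1)[OF assms]],
      rule one_sided.exp_commutator[OF vertex_exponent_pos clin_b_op b_vertex_exponent(2)[OF assms]])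

lemma exp_pos_vac: "i \<noteq> 0 \<Longrightarrow> dist_exp (vertex_exponent_pos \<kappa>) i vac = 0"
proof -
  have step: "dist_power (vertex_exponent_pos \<kappa>) (Suc j) i vac = 0" for i j
  proof (induction j arbitrary: i)
    case 0
    have "vertex_exponent_pos \<kappa> l (dist_one (i - l) vac) = 0" for l
      by (auto simp: vertex_exponent_pos_def dist_one_def heis_fock_module(2) clin_zero[OF clin_b_op])
    then show ?case by (simp add: dist_mult_def)
  next
    case (Suc j)
    then show ?case
      using clin_zero[OF one_sided.lin[OF vertex_exponent_pos]] dist_mult_def dist_power.simps(2)
      by (subst dist_power.simps(2)) (simp only: dist_mult_def Sum_any.neutral)
  qed
  assume "i \<noteq> 0"
  then have "dist_power (vertex_exponent_pos \<kappa>) j i vac = 0" for j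
    using step by (cases j) (simp_all add: dist_one_def)
  then show ?thesis by (simp add: dist_exp_def)
qed

text \<open>
  On the vacuum only the constant term of the exponential survives; applying a creation mode
  enlarges the range of nonzero coefficients by a bounded amount.
\<close>
lemma exp_pos_truncated:
  assumes "\<kappa> \<noteq> 0"
  shows "\<exists>N. \<forall>i. i < - N \<longrightarrow> dist_exp (vertex_exponent_pos \<kappa>) i v = 0"
proof (rule fock_cyclic[where P = "\<lambda>v. \<exists>N. \<forall>i. i < - N \<longrightarrow> dist_exp (vertex_exponent_pos \<kappa>) i v = 0"])
  show "\<exists>N. \<forall>i. i < - N \<longrightarrow> dist_exp (vertex_exponent_pos \<kappa>) i vac = 0"
    by (rule exI[of _ 0]) (simp add: exp_pos_vac)
next
  fix u v
  assume "\<exists>N. \<forall>i. i < - N \<longrightarrow> dist_exp (vertex_exponent_pos \<kappa>) i u = 0"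
    and "\<exists>N. \<forall>i. i < - N \<longrightarrow> dist_exp (vertex_exponent_pos \<kappa>) i v = 0"
  then obtain M N where "\<forall>i. i < - M \<longrightarrow> dist_exp (vertex_exponent_pos \<kappa>) i u = 0"
    "\<forall>i. i < - N \<longrightarrow> dist_exp (vertex_exponent_pos \<kappa>) i v = 0" by blast
  then show "\<exists>N. \<forall>i. i < - N \<longrightarrow> dist_exp (vertex_exponent_pos \<kappa>) i (u + v) = 0"
    by (intro exI[of _ "max M N"]) (auto simp: clin_add[OF exp_pos_lin])
next
  fix c v
  assume "\<exists>N. \<forall>i. i < - N \<longrightarrow> dist_exp (vertex_exponent_pos \<kappa>) i v = 0"
  then obtain N where "\<forall>i. i < - N \<longrightarrow> dist_exp (vertex_exponent_pos \<kappa>) i v = 0" by blast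
  then show "\<exists>N. \<forall>i. i < - N \<longrightarrow> dist_exp (vertex_exponent_pos \<kappa>) i (cscale c v) = 0"
    by (intro exI[of _ N]) (simp add: clin_scale[OF exp_pos_lin])
next
  fix x v
  assume "\<exists>N. \<forall>i. i < - N \<longrightarrow> dist_exp (vertex_exponent_pos \<kappa>) i v = 0"
  then obtain N where N: "\<And>i. i < - N \<Longrightarrow> dist_exp (vertex_exponent_pos \<kappa>) i v = 0" by blast
  let ?n = "- int x - 1"
  have b: "var_mult x v = b_op \<kappa> 0 ?n v" by (simp add: b_op_def)
  have "dist_exp (vertex_exponent_pos \<kappa>) i (var_mult x v) = 0" if "i < - (\<bar>N\<bar> + int x + 1)" for i
  proof -
    have "dist_exp (vertex_exponent_pos \<kappa>) i v = 0" "dist_exp (vertex_exponent_pos \<kappa>) (i - ?n) v = 0"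
      using that by (auto intro!: N)
    then show ?thesis
      using b_vertex_exp(2)[OF assms, of ?n i v] by (simp add: b clin_zero[OF clin_b_op])
  qed
  then show "\<exists>N. \<forall>i. i < - N \<longrightarrow> dist_exp (vertex_exponent_pos \<kappa>) i (var_mult x v) = 0" by blast
qed

lemma vertex_op_sum: "vertex_op \<kappa> i v = Sum_any (\<lambda>j.
    dist_exp (vertex_exponent_neg \<kappa>) j (dist_exp (vertex_exponent_pos \<kappa>) (i - j) v))"
  by (simp add: vertex_op_def shift_op_eq_id dist_mult_def)

lemma vertex_op_finite:
  assumes "\<kappa> \<noteq> 0"
  shows "finite {j. dist_exp (vertex_exponent_neg \<kappa>) j (dist_exp (vertex_exponent_pos \<kappa>) (i - j) v) \<noteq> 0}"
proof -
  obtain N where N: "\<And>i. i < - N \<Longrightarrow> dist_exp (vertex_exponent_pos \<kappa>) i v = 0"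
    using exp_pos_truncated[OF assms, of v] by blast
  show ?thesis
  proof (rule finite_int_bounded)
    fix j
    assume "j \<in> {j. dist_exp (vertex_exponent_neg \<kappa>) j (dist_exp (vertex_exponent_pos \<kappa>) (i - j) v) \<noteq> 0}"
    then have nz: "dist_exp (vertex_exponent_neg \<kappa>) j (dist_exp (vertex_exponent_pos \<kappa>) (i - j) v) \<noteq> 0" by simp
    have "\<not> j < 0" using nz one_sided.exp_supp[OF vertex_exponent_neg, of j] by auto
    moreover have "\<not> i - j < - N"
      using nz N[of "i - j"] clin_zero[OF exp_neg_lin] by auto
    ultimately show "0 \<le> j \<and> j \<le> i + N" by simp
  qed
qed

lemma clin_vertex_op:
  assumes "\<kappa> \<noteq> 0"
  shows "clin (vertex_op \<kappa> i)"
proof -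
  have "clin (\<lambda>v. dist_exp (vertex_exponent_neg \<kappa>) j (dist_exp (vertex_exponent_pos \<kappa>) (i - j) v))" for j
    by (rule clin_compose[OF exp_neg_lin exp_pos_lin])
  from clin_Sum_any[OF this vertex_op_finite[OF assms]] show ?thesis
    by (simp add: vertex_op_sum[abs_def])
qed

lemma vertex_op_zero:
  assumes "\<And>r. r \<le> i \<Longrightarrow> dist_exp (vertex_exponent_pos \<kappa>) r v = 0"
  shows "vertex_op \<kappa> i v = 0"
proof -
  have "dist_exp (vertex_exponent_neg \<kappa>) j (dist_exp (vertex_exponent_pos \<kappa>) (i - j) v) = 0" for j
    using assms[of "i - j"] one_sided.exp_supp[OF vertex_exponent_neg, of j] clin_zero[OF exp_neg_lin]
    by (cases "j < 0") auto
  then show ?thesis by (simp add: vertex_op_sum)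
qed

lemma vertex_op_vac: "i < 0 \<Longrightarrow> vertex_op \<kappa> i vac = 0"
  by (rule vertex_op_zero) (simp add: exp_pos_vac)

lemma is_field_vertex_op:
  assumes "\<kappa> \<noteq> 0"
  shows "is_field (\<lambda>r. vertex_op \<kappa> (- r))"
  unfolding is_field_def
proof (intro conjI allI)
  fix v
  obtain N where N: "\<And>i. i < - N \<Longrightarrow> dist_exp (vertex_exponent_pos \<kappa>) i v = 0"
    using exp_pos_truncated[OF assms, of v] by blast
  have "vertex_op \<kappa> (- n) v = 0" if "n \<ge> N + 1" for n
    by (rule vertex_op_zero) (use N that in auto)
  then show "\<exists>N. \<forall>n\<ge>N. vertex_op \<kappa> (- n) v = 0" by blast
qed (rule clin_vertex_op[OF assms])

text \<open>
  The factor with annihilation modes has no positive powers of the variable, so to a coefficient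
  of positive degree the other factor contributes at least one creation mode, on the left.
\<close>
lemma vertex_op_vac_coeff:
  assumes "i > 0"
  shows "Poly_Mapping.lookup (vertex_op \<kappa> i v) 0 = 0"
proof -
  have power: "Poly_Mapping.lookup (dist_power (vertex_exponent_neg \<kappa>) m j w) 0 = 0" if "j > 0" for m j w
  proof (cases m)
    case 0
    then show ?thesis using that by (simp add: dist_one_def)
  next
    case (Suc m')
    show ?thesis
      unfolding Suc dist_power.simps dist_mult_def
      by (rule Sum_any_preserves[where P = "\<lambda>w. Poly_Mapping.lookup w 0 = 0"])
        (auto simp: lookup_add vertex_exponent_neg_def b_op_def lookup_var_mult_zero)
  qed
  have exp: "Poly_Mapping.lookup (dist_exp (vertex_exponent_neg \<kappa>) j w) 0 = 0" if "j > 0" for j w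
    unfolding dist_exp_def
    by (rule Sum_any_preserves[where P = "\<lambda>w. Poly_Mapping.lookup w 0 = 0"])
      (auto simp: lookup_add power[OF that])
  have "Poly_Mapping.lookup (dist_exp (vertex_exponent_neg \<kappa>) j
      (dist_exp (vertex_exponent_pos \<kappa>) (i - j) v)) 0 = 0" for j
  proof (cases "j > 0")
    case False
    then have "dist_exp (vertex_exponent_pos \<kappa>) (i - j) v = 0"
      using assms by (intro one_sided.exp_supp[OF vertex_exponent_pos]) simp
    then show ?thesis by (simp add: clin_zero[OF exp_neg_lin])
  qed (simp add: exp)
  then show ?thesis
    unfolding vertex_op_sum
    by (intro Sum_any_preserves[where P = "\<lambda>w. Poly_Mapping.lookup w 0 = 0"]) (simp_all add: lookup_add)
qed

text \<open>
  For \<open>n = 0\<close> this is the shift of the highest weight from \<open>0\<close> to \<open>- 2\<close>.  For \<open>n \<noteq> 0\<close> the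
  commutator with one of the two exponentials vanishes and the other one gives the term with
  \<open>- 2\<close>.
\<close>
lemma b_vertex_op:
  assumes \<kappa>: "\<kappa> \<noteq> 0"
  shows "b_op \<kappa> (- 2) n (vertex_op \<kappa> i v) =
    vertex_op \<kappa> i (b_op \<kappa> 0 n v) + cscale (- 2) (vertex_op \<kappa> (i - n) v)"
proof (cases "n = 0")
  case True
  then show ?thesis by (simp add: b_op_def clin_zero[OF clin_vertex_op[OF \<kappa>]])
next
  case False
  let ?N = "dist_exp (vertex_exponent_neg \<kappa>)" and ?P = "dist_exp (vertex_exponent_pos \<kappa>)"
  let ?cn = "if n > 0 then - 2 else 0 :: complex" and ?cp = "if n < 0 then - 2 else 0 :: complex"
  \<comment> \<open>Only the zero mode depends on the highest weight.\<close>
  have "b_op \<kappa> (- 2) n (vertex_op \<kappa> i v) = b_op \<kappa> 0 n (vertex_op \<kappa> i v)"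
    using False by (simp add: b_op_def)
  also have "\<dots> = Sum_any (\<lambda>j. b_op \<kappa> 0 n (?N j (?P (i - j) v)))"
    unfolding vertex_op_sum by (rule Sum_any_clin[OF clin_b_op vertex_op_finite[OF \<kappa>]])
  also have "\<dots> = Sum_any (\<lambda>j. (?N j (?P (i - j) (b_op \<kappa> 0 n v)) +
      cscale ?cp (?N j (?P (i - n - j) v))) + cscale ?cn (?N (j - n) (?P (i - j) v)))"
  proof (rule Sum_any.cong)
    fix j
    have "i - j - n = i - n - j" by simp
    then show "b_op \<kappa> 0 n (?N j (?P (i - j) v)) = (?N j (?P (i - j) (b_op \<kappa> 0 n v)) +
      cscale ?cp (?N j (?P (i - n - j) v))) + cscale ?cn (?N (j - n) (?P (i - j) v))"
      by (simp only: b_vertex_exp[OF \<kappa>] clin_add[OF exp_neg_lin] clin_scale[OF exp_neg_lin])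
  qed
  also have "\<dots> = (Sum_any (\<lambda>j. ?N j (?P (i - j) (b_op \<kappa> 0 n v))) +
      Sum_any (\<lambda>j. cscale ?cp (?N j (?P (i - n - j) v)))) +
      Sum_any (\<lambda>j. cscale ?cn (?N (j - n) (?P (i - j) v)))"
  proof -
    have fin2: "finite {j. cscale ?cp (?N j (?P (i - n - j) v)) \<noteq> 0}"
      by (rule finite_subset[OF _ vertex_op_finite[OF \<kappa>, of "i - n" v]]) auto
    have fin12: "finite {j. ?N j (?P (i - j) (b_op \<kappa> 0 n v)) + cscale ?cp (?N j (?P (i - n - j) v)) \<noteq> 0}"
      by (rule finite_subset[OF _ finite_UnI[OF vertex_op_finite[OF \<kappa>, of i "b_op \<kappa> 0 n v"] fin2]]) auto
    have "finite {j. ?N (j - n) (?P (i - j) v) \<noteq> 0}"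
    proof (rule finite_subset)
      show "{j. ?N (j - n) (?P (i - j) v) \<noteq> 0} \<subseteq> (\<lambda>j. j + n) ` {j. ?N j (?P (i - n - j) v) \<noteq> 0}"
      proof
        fix j assume "j \<in> {j. ?N (j - n) (?P (i - j) v) \<noteq> 0}"
        then have "j - n \<in> {j. ?N j (?P (i - n - j) v) \<noteq> 0}" by simp
        then show "j \<in> (\<lambda>j. j + n) ` {j. ?N j (?P (i - n - j) v) \<noteq> 0}"
          by (rule rev_image_eqI) simp
      qed
    qed (rule finite_imageI[OF vertex_op_finite[OF \<kappa>]])
    then have fin3: "finite {j. cscale ?cn (?N (j - n) (?P (i - j) v)) \<noteq> 0}"
      by (rule rev_finite_subset) auto
    show ?thesis by (simp only: Sum_any.distrib vertex_op_finite[OF \<kappa>] fin2 fin12 fin3)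
  qed
  also have "Sum_any (\<lambda>j. cscale ?cn (?N (j - n) (?P (i - j) v))) =
      Sum_any (\<lambda>j. cscale ?cn (?N j (?P (i - n - j) v)))"
    using Sum_any_shift[of "\<lambda>j. cscale ?cn (?N j (?P (i - n - j) v))" "- n"]
    by (simp only: diff_conv_add_uminus[symmetric] diff_diff_eq2 diff_add_cancel)
  also have "\<dots> = cscale ?cn (vertex_op \<kappa> (i - n) v)"
    unfolding vertex_op_sum
    by (rule Sum_any_clin[OF clin_cscale[OF clin_ident] vertex_op_finite[OF \<kappa>], symmetric])
  also have "Sum_any (\<lambda>j. cscale ?cp (?N j (?P (i - n - j) v))) = cscale ?cp (vertex_op \<kappa> (i - n) v)"
    unfolding vertex_op_sum
    by (rule Sum_any_clin[OF clin_cscale[OF clin_ident] vertex_op_finite[OF \<kappa>], symmetric])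
  also have "Sum_any (\<lambda>j. ?N j (?P (i - j) (b_op \<kappa> 0 n v))) = vertex_op \<kappa> i (b_op \<kappa> 0 n v)"
    by (rule vertex_op_sum[symmetric])
  finally show ?thesis using False by (cases "n > 0") simp_all
qed

text \<open>
  The index is negated so that, as for the other fields, the modes with large index annihilate.
\<close>
definition v_mode :: "complex \<Rightarrow> int \<Rightarrow> wakimoto_space \<Rightarrow> wakimoto_space"
  where "v_mode \<kappa> r = tensor_map id (vertex_op \<kappa> (- r))"

lemma is_field_v: "\<kappa> \<noteq> 0 \<Longrightarrow> is_field (v_mode \<kappa>)"
  unfolding v_mode_def[abs_def] by (rule is_field_tensor_right[OF is_field_vertex_op])

lemma v_mode_tensor: "\<kappa> \<noteq> 0 \<Longrightarrow> v_mode \<kappa> r (tensor x y) = tensor x (vertex_op \<kappa> (- r) y)"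
  by (simp add: v_mode_def tensor_map_tensor clin_id clin_vertex_op)

lemma v_a_mode: "\<kappa> \<noteq> 0 \<Longrightarrow> v_mode \<kappa> r (a_mode n v) = a_mode n (v_mode \<kappa> r v)"
  and v_as_mode: "\<kappa> \<noteq> 0 \<Longrightarrow> v_mode \<kappa> r (as_mode n v) = as_mode n (v_mode \<kappa> r v)"
  by (simp_all add: v_mode_def tensor_map_right_commute clin_vertex_op)

lemma b_v_mode:
  assumes "\<kappa> \<noteq> 0"
  shows "b_mode \<kappa> (- 2) n (v_mode \<kappa> r v) =
    v_mode \<kappa> r (b_mode \<kappa> 0 n v) + cscale (- 2) (v_mode \<kappa> (r + n) v)"
proof (rule tensor_eqI[where g = "\<lambda>v. b_mode \<kappa> (- 2) n (v_mode \<kappa> r v)"])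
  note lin = field_clin[OF is_field_v[OF assms]]
  show "clin (\<lambda>v. b_mode \<kappa> (- 2) n (v_mode \<kappa> r v))"
    by (rule clin_compose[OF clin_modes(3) lin])
  show "clin (\<lambda>v. v_mode \<kappa> r (b_mode \<kappa> 0 n v) + cscale (- 2) (v_mode \<kappa> (r + n) v))"
    by (rule clin_plus[OF clin_compose[OF lin clin_modes(3)] clin_cscale[OF lin]])
  show "b_mode \<kappa> (- 2) n (v_mode \<kappa> r (tensor x y)) =
    v_mode \<kappa> r (b_mode \<kappa> 0 n (tensor x y)) + cscale (- 2) (v_mode \<kappa> (r + n) (tensor x y))" for x y
    using b_vertex_op[OF assms, of n "- r" y]
    by (simp add: v_mode_tensor[OF assms] mode_tensor tensor_linear)
qed

lemma v_mode_vac: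
  assumes "\<kappa> \<noteq> 0"
  shows "r > 0 \<Longrightarrow> v_mode \<kappa> r wvac = 0"
    and "r < 0 \<Longrightarrow> Poly_Mapping.lookup (v_mode \<kappa> r wvac) (0, 0) = 0"
  using assms by (simp_all add: v_mode_tensor vertex_op_vac tensor_linear lookup_tensor vertex_op_vac_coeff)

section \<open>The currents\<close>

text \<open>
  The current \<open>:a\<^sup>* a:\<close>; its zero mode is the number of factors \<open>a\<^sup>*\<close> minus the number of
  factors \<open>a\<close>.
\<close>
abbreviation num_mode :: "int \<Rightarrow> wakimoto_space \<Rightarrow> wakimoto_space"
  where "num_mode \<equiv> nop as_mode a_mode"

abbreviation asnum_mode :: "int \<Rightarrow> wakimoto_space \<Rightarrow> wakimoto_space"
  where "asnum_mode \<equiv> nop as_mode num_mode"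

abbreviation asas_mode :: "int \<Rightarrow> wakimoto_space \<Rightarrow> wakimoto_space"
  where "asas_mode \<equiv> nop as_mode as_mode"

abbreviation asb_mode :: "complex \<Rightarrow> complex \<Rightarrow> int \<Rightarrow> wakimoto_space \<Rightarrow> wakimoto_space"
  where "asb_mode \<kappa> \<nu> \<equiv> nop as_mode (b_mode \<kappa> \<nu>)"

definition h_mode :: "complex \<Rightarrow> complex \<Rightarrow> int \<Rightarrow> wakimoto_space \<Rightarrow> wakimoto_space"
  where "h_mode k \<nu> n v = cscale (- 2) (num_mode n v) + b_mode (k + 2) \<nu> n v"

definition f_mode :: "complex \<Rightarrow> complex \<Rightarrow> int \<Rightarrow> wakimoto_space \<Rightarrow> wakimoto_space"
  where "f_mode k \<nu> n v = cscale (- 1) (asnum_mode n v) +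
    (cscale (- k * of_int n) (as_mode n v) + asb_mode (k + 2) \<nu> n v)"

lemmas is_field_num = is_field_nop[OF is_field_as is_field_a]
lemmas is_field_asnum = is_field_nop[OF is_field_as is_field_num]
lemmas is_field_asas = is_field_nop[OF is_field_as is_field_as]
lemmas is_field_asb = is_field_nop[OF is_field_as is_field_b]

lemmas clin_currents = clin_modes field_clin[OF is_field_num] field_clin[OF is_field_asnum]
  field_clin[OF is_field_asas] field_clin[OF is_field_asb]

lemma clin_h_mode: "clin (h_mode k \<nu> n)"
  unfolding h_mode_def[abs_def] by (intro clin_plus clin_cscale clin_currents)

lemma clin_f_mode: "clin (f_mode k \<nu> n)"
  unfolding f_mode_def[abs_def] by (intro clin_plus clin_cscale clin_currents)

lemma as_a_mode: "as_mode m (a_mode n v) = a_mode n (as_mode m v) + (if n = - m then cscale (- 1) v else 0)"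
  by (auto simp: a_as_mode vec_eq)

lemma a_num: "a_mode p (num_mode n v) = num_mode n (a_mode p v) + a_mode (n + p) v"
proof -
  have 1: "a_mode p (as_mode l u) = as_mode l (a_mode p u) + (if l = - p then cscale 1 u else 0)" for l u
    by (simp add: a_as_mode)
  have 2: "a_mode p (a_mode r u) = a_mode r (a_mode p u) + 0" for r u
    using a_a_mode[of p r u] by simp
  from nop_leibniz[where P = as_mode and Q = a_mode and X = "a_mode p" and Y = "a_mode p" and n = n and v = v
      and P' = "\<lambda>r u. if r = - p then cscale 1 u else 0" and Q' = "\<lambda>r u. 0",
      OF is_field_as is_field_a is_field_delta is_field_zero clin_modes(1,1) 1 1 2]
  show ?thesis
    by (simp add: nop_delta_left[OF is_field_a] nop_zero_right[OF is_field_as])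
qed

lemma as_num: "as_mode p (num_mode n v) = num_mode n (as_mode p v) + cscale (- 1) (as_mode (n + p) v)"
proof -
  have 1: "as_mode p (as_mode l u) = as_mode l (as_mode p u) + 0" for l u
    using as_as_mode[of p l u] by simp
  from nop_leibniz[where P = as_mode and Q = a_mode and X = "as_mode p" and Y = "as_mode p" and n = n and v = v
      and P' = "\<lambda>r u. 0" and Q' = "\<lambda>r u. if r = - p then cscale (- 1) u else 0",
      OF is_field_as is_field_a is_field_zero is_field_delta clin_modes(2,2) 1 1 as_a_mode]
  show ?thesis
    by (simp add: nop_delta_right[OF is_field_as] nop_zero_left[OF is_field_a])
qed

lemma num_a: "num_mode n (a_mode p v) = a_mode p (num_mode n v) + cscale (- 1) (a_mode (p + n) v)"
  and num_as: "num_mode n (as_mode p v) = as_mode p (num_mode n v) + as_mode (p + n) v"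
  using a_num[of p n v] as_num[of p n v] by (simp_all add: vec_eq add_ac)

text \<open>
  \<open>:a\<^sup>* a:\<close> is a Heisenberg current of level \<open>- 1\<close>: the two Leibniz terms cancel up to the
  reordering of the first one.
\<close>
lemma num_num: "num_mode n (num_mode m v) =
    num_mode m (num_mode n v) + (if m = - n then cscale (- of_int n) v else 0)"
proof -
  have "nop (\<lambda>l. as_mode (l + n)) a_mode m v =
      num_mode (m + n) v + cscale (of_int n) (if m + n = 0 then cscale (- 1) v else 0)"
    by (rule nop_shift_left[OF is_field_as is_field_a, where Z = "\<lambda>s. if s = 0 then cscale (- 1) v else 0"])
      (simp add: as_a_mode add_eq_0_iff)
  moreover have "nop as_mode (\<lambda>r u. cscale (- 1) (a_mode (r + n) u)) m v = cscale (- 1) (num_mode (m + n) v)"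
    by (simp add: nop_scale_right is_field_as is_field_shift[OF is_field_a] nop_shift_right)
  moreover note nop_leibniz[where P = as_mode and Q = a_mode and X = "num_mode n" and Y = "num_mode n" and n = m and v = v
      and P' = "\<lambda>r. as_mode (r + n)" and Q' = "\<lambda>r u. cscale (- 1) (a_mode (r + n) u)",
      OF is_field_as is_field_a is_field_shift[OF is_field_as]
      is_field_scale[OF is_field_shift[OF is_field_a]] clin_currents(4,4) num_as num_as num_a]
  ultimately show ?thesis by (auto simp: vec_eq)
qed

text \<open>
  Applied to \<open>b\<close>, to \<open>V\<close>, and to the defect of the screening relation.
\<close>
lemma commute_num:
  assumes X: "clin X" and "\<And>n v. X (a_mode n v) = a_mode n (X v)" "\<And>n v. X (as_mode n v) = as_mode n (X v)"
  shows "X (num_mode n v) = num_mode n (X v)"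
proof -
  have 1: "X (as_mode l u) = as_mode l (X u) + 0" "X (a_mode l u) = a_mode l (X u) + 0" for l u
    by (simp_all add: assms)
  from nop_leibniz[where P = as_mode and Q = a_mode and X = X and Y = X and n = n and v = v
      and P' = "\<lambda>r u. 0" and Q' = "\<lambda>r u. 0",
      OF is_field_as is_field_a is_field_zero is_field_zero X X 1(1) 1(1) 1(2)]
  show ?thesis by (simp add: nop_zero_left[OF is_field_a] nop_zero_right[OF is_field_as])
qed

lemma commute_asnum:
  assumes X: "clin X" and "\<And>n v. X (a_mode n v) = a_mode n (X v)" "\<And>n v. X (as_mode n v) = as_mode n (X v)"
  shows "X (asnum_mode n v) = asnum_mode n (X v)"
proof -
  have 1: "X (as_mode l u) = as_mode l (X u) + 0" "X (num_mode l u) = num_mode l (X u) + 0" for l u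
    by (simp_all add: assms commute_num[OF assms])
  from nop_leibniz[where P = as_mode and Q = num_mode and X = X and Y = X and n = n and v = v
      and P' = "\<lambda>r u. 0" and Q' = "\<lambda>r u. 0",
      OF is_field_as is_field_num is_field_zero is_field_zero X X 1(1) 1(1) 1(2)]
  show ?thesis by (simp add: nop_zero_left[OF is_field_num] nop_zero_right[OF is_field_as])
qed

lemma commute_asas:
  assumes X: "clin X" and "\<And>n v. X (as_mode n v) = as_mode n (X v)"
  shows "X (asas_mode n v) = asas_mode n (X v)"
proof -
  have 1: "X (as_mode l u) = as_mode l (X u) + 0" for l u
    by (simp_all add: assms)
  from nop_leibniz[where P = as_mode and Q = as_mode and X = X and Y = X and n = n and v = v
      and P' = "\<lambda>r u. 0" and Q' = "\<lambda>r u. 0",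
      OF is_field_as is_field_as is_field_zero is_field_zero X X 1 1 1]
  show ?thesis by (simp add: nop_zero_left[OF is_field_as] nop_zero_right[OF is_field_as])
qed

lemmas b_num = commute_num[OF clin_modes(3) b_a_mode b_as_mode]
lemmas b_asnum = commute_asnum[OF clin_modes(3) b_a_mode b_as_mode]

lemma h_a: "h_mode k \<nu> n (a_mode p v) = a_mode p (h_mode k \<nu> n v) + cscale 2 (a_mode (p + n) v)"
  and h_as: "h_mode k \<nu> n (as_mode p v) = as_mode p (h_mode k \<nu> n v) + cscale (- 2) (as_mode (p + n) v)"
  by (simp_all add: h_mode_def num_a num_as b_a_mode b_as_mode clin_add[OF clin_modes(1)] clin_add[OF clin_modes(2)]
      clin_scale[OF clin_modes(1)] clin_scale[OF clin_modes(2)] vec_eq)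

lemma h_b: "h_mode k \<nu> n (b_mode (k + 2) \<nu> p v) =
    b_mode (k + 2) \<nu> p (h_mode k \<nu> n v) + (if p = - n then cscale (2 * (k + 2) * of_int n) v else 0)"
  by (simp add: h_mode_def b_num clin_add[OF clin_modes(3)] clin_scale[OF clin_modes(3)]
      b_b_mode[of "k + 2" \<nu> n p v])

lemma h_num: "h_mode k \<nu> n (num_mode m v) =
    num_mode m (h_mode k \<nu> n v) + (if m = - n then cscale (2 * of_int n) v else 0)"
  by (simp add: h_mode_def b_num clin_add[OF clin_currents(4)] clin_scale[OF clin_currents(4)]
      num_num[of n m v] vec_eq)

text \<open>
  \<open>4 \<cdot> (- n)\<close> from \<open>:a\<^sup>* a:\<close> and \<open>2 (k + 2) n\<close> from \<open>b\<close> add up to level \<open>k\<close>.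
\<close>
lemma h_h: "h_mode k \<nu> n (h_mode k \<nu> m v) =
    h_mode k \<nu> m (h_mode k \<nu> n v) + (if m = - n then cscale (2 * k * of_int n) v else 0)"
proof -
  have "h_mode k \<nu> n (h_mode k \<nu> m v) =
      cscale (- 2) (h_mode k \<nu> n (num_mode m v)) + h_mode k \<nu> n (b_mode (k + 2) \<nu> m v)"
    by (simp add: h_mode_def[of k \<nu> m] clin_add[OF clin_h_mode] clin_scale[OF clin_h_mode])
  also have "\<dots> = cscale (- 2) (num_mode m (h_mode k \<nu> n v)) + b_mode (k + 2) \<nu> m (h_mode k \<nu> n v) +
      (if m = - n then cscale (2 * k * of_int n) v else 0)"
    by (auto simp: h_num h_b vec_eq algebra_simps)
  finally show ?thesis by (simp add: h_mode_def[of k \<nu> m "h_mode k \<nu> n v"])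
qed

lemma a_asnum: "a_mode p (asnum_mode n v) = asnum_mode n (a_mode p v) + cscale 2 (num_mode (n + p) v)"
proof -
  have 1: "a_mode p (as_mode l u) = as_mode l (a_mode p u) + (if l = - p then cscale 1 u else 0)" for l u
    by (simp add: a_as_mode)
  from nop_leibniz[where P = as_mode and Q = num_mode and X = "a_mode p" and Y = "a_mode p" and n = n and v = v
      and P' = "\<lambda>r u. if r = - p then cscale 1 u else 0" and Q' = "\<lambda>r. a_mode (r + p)",
      OF is_field_as is_field_num is_field_delta is_field_shift[OF is_field_a]
      clin_modes(1,1) 1 1 a_num]
  show ?thesis by (simp add: nop_delta_left[OF is_field_num] nop_shift_right vec_eq)
qed

lemma as_asnum: "as_mode p (asnum_mode n v) = asnum_mode n (as_mode p v) + cscale (- 1) (asas_mode (n + p) v)"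
proof -
  have 1: "as_mode p (as_mode l u) = as_mode l (as_mode p u) + 0" for l u
    using as_as_mode[of p l u] by simp
  from nop_leibniz[where P = as_mode and Q = num_mode and X = "as_mode p" and Y = "as_mode p" and n = n and v = v
      and P' = "\<lambda>r u. 0" and Q' = "\<lambda>r u. cscale (- 1) (as_mode (r + p) u)",
      OF is_field_as is_field_num is_field_zero is_field_scale[OF is_field_shift[OF is_field_as]]
      clin_modes(2,2) 1 1 as_num]
  show ?thesis
    by (simp add: nop_zero_left[OF is_field_num] nop_scale_right is_field_as is_field_shift[OF is_field_as]
        nop_shift_right)
qed

text \<open>
  The anomaly \<open>4 n\<close> is half due to reordering and half to the level of \<open>:a\<^sup>* a:\<close>.
\<close>
lemma h_asnum: "h_mode k \<nu> n (asnum_mode m v) = asnum_mode m (h_mode k \<nu> n v) +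
    (cscale (- 2) (asnum_mode (m + n) v) + cscale (4 * of_int n) (as_mode (m + n) v))"
proof -
  have "nop (\<lambda>l. as_mode (l + n)) num_mode m v =
      asnum_mode (m + n) v + cscale (of_int n) (cscale (- 1) (as_mode (m + n) v))"
    by (rule nop_shift_left[OF is_field_as is_field_num, where Z = "\<lambda>s. cscale (- 1) (as_mode s v)"])
      (simp add: as_num add.commute)
  moreover have "nop (\<lambda>l u. cscale (- 2) (as_mode (l + n) u)) num_mode m v =
      cscale (- 2) (nop (\<lambda>l. as_mode (l + n)) num_mode m v)"
    by (rule nop_scale_left[OF is_field_shift[OF is_field_as] is_field_num])
  moreover note nop_leibniz[where P = as_mode and Q = num_mode and X = "h_mode k \<nu> n" and Y = "h_mode k \<nu> n" and n = m and v = v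
      and P' = "\<lambda>r u. cscale (- 2) (as_mode (r + n) u)" and Q' = "\<lambda>r u. if r = - n then cscale (2 * of_int n) u else 0",
      OF is_field_as is_field_num is_field_scale[OF is_field_shift[OF is_field_as]]
      is_field_delta clin_h_mode clin_h_mode h_as h_as h_num]
  ultimately show ?thesis by (simp add: nop_delta_right[OF is_field_as] vec_eq)
qed

lemma a_asb: "a_mode p (asb_mode \<kappa> \<nu> n v) = asb_mode \<kappa> \<nu> n (a_mode p v) + b_mode \<kappa> \<nu> (n + p) v"
proof -
  have 1: "a_mode p (as_mode l u) = as_mode l (a_mode p u) + (if l = - p then cscale 1 u else 0)" for l u
    by (simp add: a_as_mode)
  have 2: "a_mode p (b_mode \<kappa> \<nu> r u) = b_mode \<kappa> \<nu> r (a_mode p u) + 0" for r u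
    by (simp add: b_a_mode)
  from nop_leibniz[where P = as_mode and Q = "b_mode \<kappa> \<nu>" and X = "a_mode p" and Y = "a_mode p" and n = n and v = v
      and P' = "\<lambda>r u. if r = - p then cscale 1 u else 0" and Q' = "\<lambda>r u. 0",
      OF is_field_as is_field_b is_field_delta is_field_zero clin_modes(1,1) 1 1 2]
  show ?thesis by (simp add: nop_delta_left[OF is_field_b] nop_zero_right[OF is_field_as])
qed

lemma as_asb: "as_mode p (asb_mode \<kappa> \<nu> n v) = asb_mode \<kappa> \<nu> n (as_mode p v)"
proof -
  have 1: "as_mode p (as_mode l u) = as_mode l (as_mode p u) + 0" for l u
    using as_as_mode[of p l u] by simp
  have 2: "as_mode p (b_mode \<kappa> \<nu> r u) = b_mode \<kappa> \<nu> r (as_mode p u) + 0" for r u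
    by (simp add: b_as_mode)
  from nop_leibniz[where P = as_mode and Q = "b_mode \<kappa> \<nu>" and X = "as_mode p" and Y = "as_mode p" and n = n and v = v
      and P' = "\<lambda>r u. 0" and Q' = "\<lambda>r u. 0",
      OF is_field_as is_field_b is_field_zero is_field_zero clin_modes(2,2) 1 1 2]
  show ?thesis by (simp add: nop_zero_left[OF is_field_b] nop_zero_right[OF is_field_as])
qed

lemma b_asb: "b_mode \<kappa> \<nu> p (asb_mode \<kappa> \<nu> n v) =
    asb_mode \<kappa> \<nu> n (b_mode \<kappa> \<nu> p v) + cscale (2 * \<kappa> * of_int p) (as_mode (n + p) v)"
proof -
  have 1: "b_mode \<kappa> \<nu> p (as_mode l u) = as_mode l (b_mode \<kappa> \<nu> p u) + 0" for l u
    by (simp add: b_as_mode)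
  from nop_leibniz[where P = as_mode and Q = "b_mode \<kappa> \<nu>" and X = "b_mode \<kappa> \<nu> p" and Y = "b_mode \<kappa> \<nu> p" and n = n and v = v
      and P' = "\<lambda>r u. 0" and Q' = "\<lambda>r u. if r = - p then cscale (2 * \<kappa> * of_int p) u else 0",
      OF is_field_as is_field_b is_field_zero is_field_delta clin_modes(3,3) 1 1 b_b_mode]
  show ?thesis by (simp add: nop_zero_left[OF is_field_b] nop_delta_right[OF is_field_as])
qed

lemma h_asb: "h_mode k \<nu> n (asb_mode (k + 2) \<nu> m v) = asb_mode (k + 2) \<nu> m (h_mode k \<nu> n v) +
    (cscale (- 2) (asb_mode (k + 2) \<nu> (m + n) v) + cscale (2 * (k + 2) * of_int n) (as_mode (m + n) v))"
proof -
  have "nop (\<lambda>l. as_mode (l + n)) (b_mode (k + 2) \<nu>) m v = asb_mode (k + 2) \<nu> (m + n) v + cscale (of_int n) 0"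
    by (rule nop_shift_left[OF is_field_as is_field_b, where Z = "\<lambda>s. 0"]) (simp add: b_as_mode)
  moreover have "nop (\<lambda>l u. cscale (- 2) (as_mode (l + n) u)) (b_mode (k + 2) \<nu>) m v =
      cscale (- 2) (nop (\<lambda>l. as_mode (l + n)) (b_mode (k + 2) \<nu>) m v)"
    by (rule nop_scale_left[OF is_field_shift[OF is_field_as] is_field_b])
  moreover note nop_leibniz[where P = as_mode and Q = "b_mode (k + 2) \<nu>" and X = "h_mode k \<nu> n" and Y = "h_mode k \<nu> n" and n = m and v = v
      and P' = "\<lambda>r u. cscale (- 2) (as_mode (r + n) u)" and Q' = "\<lambda>r u. if r = - n then cscale (2 * (k + 2) * of_int n) u else 0",
      OF is_field_as is_field_b is_field_scale[OF is_field_shift[OF is_field_as]]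
      is_field_delta clin_h_mode clin_h_mode h_as h_as h_b]
  ultimately show ?thesis by (simp add: nop_delta_right[OF is_field_as])
qed

lemma a_f: "a_mode p (f_mode k \<nu> m v) = f_mode k \<nu> m (a_mode p v) +
    (h_mode k \<nu> (m + p) v + (if m = - p then cscale (k * of_int p) v else 0))"
  by (auto simp: f_mode_def h_mode_def clin_add[OF clin_modes(1)] clin_scale[OF clin_modes(1)]
      a_asnum a_asb a_as_mode vec_eq algebra_simps)

lemma as_f: "as_mode p (f_mode k \<nu> m v) = f_mode k \<nu> m (as_mode p v) + asas_mode (m + p) v"
  by (simp add: f_mode_def clin_add[OF clin_modes(2)] clin_scale[OF clin_modes(2)]
      as_asnum as_asb as_as_mode[of p m v] vec_eq)

lemma b_f: "b_mode (k + 2) \<nu> p (f_mode k \<nu> m v) =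
    f_mode k \<nu> m (b_mode (k + 2) \<nu> p v) + cscale (2 * (k + 2) * of_int p) (as_mode (m + p) v)"
  by (simp add: f_mode_def clin_add[OF clin_modes(3)] clin_scale[OF clin_modes(3)]
      b_asnum b_asb b_as_mode vec_eq)

text \<open>
  The anomalies \<open>- 4 n\<close> of the cubic term and \<open>2 (k + 2) n\<close> of the last term combine to \<open>2 k n\<close>,
  which turns the coefficient \<open>k m\<close> of the derivative term \<open>k \<partial>a\<^sup>*\<close> into \<open>k (m + n)\<close>.
\<close>
lemma h_f: "h_mode k \<nu> n (f_mode k \<nu> m v) = f_mode k \<nu> m (h_mode k \<nu> n v) + cscale (- 2) (f_mode k \<nu> (m + n) v)"
  by (simp add: f_mode_def clin_add[OF clin_h_mode] clin_scale[OF clin_h_mode]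
      h_asnum h_asb h_as vec_eq algebra_simps)

lemma as_asas: "as_mode p (asas_mode n v) = asas_mode n (as_mode p v)"
  by (rule commute_asas[OF clin_modes(2) as_as_mode])

lemma f_as: "f_mode k \<nu> m (as_mode p v) = as_mode p (f_mode k \<nu> m v) + cscale (- 1) (asas_mode (p + m) v)"
  using as_f[of p k \<nu> m v] by (simp add: vec_eq add.commute)

text \<open>
  The right-hand side depends on \<open>m\<close> and \<open>r\<close> through \<open>r + m\<close> only; this makes the commutator of two
  modes of \<open>f\<close> commute with \<open>a\<^sup>*\<close>.
\<close>
lemma f_asas: "f_mode k \<nu> m (asas_mode r v) = asas_mode r (f_mode k \<nu> m v) +
    cscale (- 1) (nop asas_mode as_mode (r + m) v + nop as_mode asas_mode (r + m) v)"
proof -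
  have "nop (\<lambda>l. asas_mode (l + m)) as_mode r v = nop asas_mode as_mode (r + m) v + cscale (of_int m) 0"
    by (rule nop_shift_left[OF is_field_asas is_field_as, where Z = "\<lambda>s. 0"]) (simp add: as_asas)
  moreover have "nop (\<lambda>l u. cscale (- 1) (asas_mode (l + m) u)) as_mode r v =
      cscale (- 1) (nop (\<lambda>l. asas_mode (l + m)) as_mode r v)"
    by (rule nop_scale_left[OF is_field_shift[OF is_field_asas] is_field_as])
  moreover have "nop as_mode (\<lambda>l u. cscale (- 1) (asas_mode (l + m) u)) r v =
      cscale (- 1) (nop as_mode asas_mode (r + m) v)"
    by (simp add: nop_scale_right is_field_as is_field_shift[OF is_field_asas] nop_shift_right)
  moreover note nop_leibniz[where P = as_mode and Q = as_mode and X = "f_mode k \<nu> m" and Y = "f_mode k \<nu> m" and n = r and v = v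
      and P' = "\<lambda>r u. cscale (- 1) (asas_mode (r + m) u)" and Q' = "\<lambda>r u. cscale (- 1) (asas_mode (r + m) u)",
      OF is_field_as is_field_as is_field_scale[OF is_field_shift[OF is_field_asas]]
      is_field_scale[OF is_field_shift[OF is_field_asas]] clin_f_mode clin_f_mode f_as f_as f_as]
  ultimately show ?thesis by (simp add: vec_eq)
qed

lemma num_annihilated:
  assumes "\<And>n. n \<ge> 0 \<Longrightarrow> a_mode n u = 0" "\<And>n. n > 0 \<Longrightarrow> as_mode n u = 0"
  shows "n \<ge> 0 \<Longrightarrow> num_mode n u = 0"
proof -
  assume n: "n \<ge> 0"
  have "(if l \<le> 0 then as_mode l (a_mode (n - l) u) else a_mode (n - l) (as_mode l u)) = 0" for l
    using n by (simp add: assms clin_zero[OF clin_modes(1)] clin_zero[OF clin_modes(2)])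
  then show ?thesis by (simp add: nop_def)
qed

lemma h_zero_annihilated:
  assumes "\<And>n. n \<ge> 0 \<Longrightarrow> a_mode n u = 0" "\<And>n. n > 0 \<Longrightarrow> as_mode n u = 0"
  shows "h_mode k \<nu> 0 u = cscale \<nu> u"
  by (simp add: h_mode_def num_annihilated[OF assms] mode_vac(4))

text \<open>
  The vacuum generates the module.
\<close>
lemma zero_if_commutes_with_modes:
  assumes "X wvac = 0" "clin X"
    and "\<And>n v. X (a_mode n v) = a_mode n (X v)" "\<And>n v. X (as_mode n v) = as_mode n (X v)"
    and "\<And>n v. X (b_mode \<kappa> \<nu> n v) = b_mode \<kappa> \<nu>' n (X v)"
  shows "X v = 0"
  by (rule wakimoto_induct[where P = "\<lambda>v. X v = 0" and \<kappa> = \<kappa> and \<nu> = \<nu>])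
    (simp_all add: assms(1,3,4,5) clin_add[OF assms(2)] clin_scale[OF assms(2)] clin_zero[OF clin_modes(1)]
      clin_zero[OF clin_modes(2)] clin_zero[OF clin_modes(3)])

text \<open>
  The commutator commutes with all free modes, and its value on the vacuum would have two different
  weights under \<open>h\<^sub>0\<close>.
\<close>
lemma f_f: "f_mode k \<nu> n (f_mode k \<nu> m v) = f_mode k \<nu> m (f_mode k \<nu> n v)"
proof -
  define X where "X v = f_mode k \<nu> n (f_mode k \<nu> m v) - f_mode k \<nu> m (f_mode k \<nu> n v)" for v
  have lin: "clin X"
    unfolding X_def[abs_def] by (intro clin_sub clin_compose[OF clin_f_mode clin_f_mode])
  note lins = clin_add[OF clin_f_mode] clin_scale[OF clin_f_mode] clin_diff[OF clin_f_mode]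
    clin_diff[OF clin_modes(1)] clin_diff[OF clin_modes(2)] clin_diff[OF clin_modes(3)] clin_zero[OF clin_f_mode]
  have fa: "f_mode k \<nu> m (a_mode p v) = a_mode p (f_mode k \<nu> m v) -
    (h_mode k \<nu> (m + p) v + (if m = - p then cscale (k * of_int p) v else 0))" for m p v
    using a_f[of p k \<nu> m v] by (simp add: vec_eq)
  have fb: "f_mode k \<nu> m (b_mode (k + 2) \<nu> p v) = b_mode (k + 2) \<nu> p (f_mode k \<nu> m v) +
      cscale (- (2 * (k + 2) * of_int p)) (as_mode (m + p) v)" for m p v
    using b_f[of k \<nu> p m v] by (simp add: vec_eq)
  have a: "X (a_mode p v) = a_mode p (X v)" for p v
    by (auto simp: X_def fa h_f lins vec_eq algebra_simps)
  have as: "X (as_mode p v) = as_mode p (X v)" for p v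
    by (simp add: X_def f_as f_asas lins vec_eq algebra_simps)
  have b: "X (b_mode (k + 2) \<nu> p v) = b_mode (k + 2) \<nu> p (X v)" for p v
    by (simp add: X_def fb f_as lins vec_eq algebra_simps)
  have "h_mode k \<nu> 0 (X wvac) = cscale \<nu> (X wvac)"
    by (rule h_zero_annihilated) (simp_all add: mode_vac clin_zero[OF lin] flip: a as)
  moreover have "h_mode k \<nu> 0 wvac = cscale \<nu> wvac"
    by (rule h_zero_annihilated) (simp_all add: mode_vac)
  moreover have "h_mode k \<nu> 0 (X v) = X (h_mode k \<nu> 0 v) + cscale (- 4) (X v)" for v
    by (simp add: X_def clin_diff[OF clin_h_mode] h_f lins vec_eq)
  ultimately have "X wvac = 0"
    by (simp add: clin_scale[OF lin] vec_eq)
  from zero_if_commutes_with_modes[OF this lin a as b] show ?thesis by (simp add: X_def)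
qed

section \<open>The screening field\<close>

context
  fixes k :: complex
  assumes level: "k + 2 \<noteq> 0"
begin

abbreviation V :: "int \<Rightarrow> wakimoto_space \<Rightarrow> wakimoto_space"
  where "V \<equiv> v_mode (k + 2)"

text \<open>
  \<open>S p\<close> is the coefficient of \<open>w\<^sup>-\<^sup>p\<^sup>-\<^sup>1\<close> in the screening field; the residue is \<open>S 0\<close>.
\<close>
abbreviation S :: "int \<Rightarrow> wakimoto_space \<Rightarrow> wakimoto_space"
  where "S \<equiv> nop a_mode V"

abbreviation asv_mode :: "int \<Rightarrow> wakimoto_space \<Rightarrow> wakimoto_space"
  where "asv_mode \<equiv> nop as_mode V"

lemmas is_field_V = is_field_v[OF level]
lemmas clin_V = field_clin[OF is_field_V]
lemmas is_field_S = is_field_nop[OF is_field_a is_field_V]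
lemmas clin_S = field_clin[OF is_field_S]

lemmas V_a = v_a_mode[OF level] and V_as = v_as_mode[OF level]

lemma a_S: "a_mode q (S p v) = S p (a_mode q v)"
proof -
  have 1: "a_mode q (a_mode l u) = a_mode l (a_mode q u) + 0" for l u
    using a_a_mode[of q l u] by simp
  have 2: "a_mode q (V r u) = V r (a_mode q u) + 0" for r u
    by (simp add: V_a)
  from nop_leibniz[where P = a_mode and Q = V and X = "a_mode q" and Y = "a_mode q" and n = p and v = v
      and P' = "\<lambda>r u. 0" and Q' = "\<lambda>r u. 0",
      OF is_field_a is_field_V is_field_zero is_field_zero clin_modes(1,1) 1 1 2]
  show ?thesis by (simp add: nop_zero_left[OF is_field_V] nop_zero_right[OF is_field_a])
qed

lemma as_S: "as_mode q (S p v) = S p (as_mode q v) + cscale (- 1) (V (p + q) v)"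
proof -
  have 2: "as_mode q (V r u) = V r (as_mode q u) + 0" for r u
    by (simp add: V_as)
  from nop_leibniz[where P = a_mode and Q = V and X = "as_mode q" and Y = "as_mode q" and n = p and v = v
      and P' = "\<lambda>r u. if r = - q then cscale (- 1) u else 0" and Q' = "\<lambda>r u. 0",
      OF is_field_a is_field_V is_field_delta is_field_zero clin_modes(2,2) as_a_mode as_a_mode 2]
  show ?thesis by (simp add: nop_delta_left[OF is_field_V] nop_zero_right[OF is_field_a])
qed

lemma b_S: "b_mode (k + 2) (- 2) q (S p v) = S p (b_mode (k + 2) 0 q v) + cscale (- 2) (S (p + q) v)"
proof -
  have 1: "b_mode (k + 2) \<nu> q (a_mode l u) = a_mode l (b_mode (k + 2) \<nu> q u) + 0" for l u \<nu>
    by (simp add: b_a_mode)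
  from nop_leibniz[where P = a_mode and Q = V and X = "b_mode (k + 2) (- 2) q" and Y = "b_mode (k + 2) 0 q"
      and n = p and v = v
      and P' = "\<lambda>r u. 0" and Q' = "\<lambda>r u. cscale (- 2) (V (r + q) u)",
      OF is_field_a is_field_V is_field_zero is_field_scale[OF is_field_shift[OF is_field_V]]
      clin_modes(3,3) 1 1 b_v_mode[OF level]]
  show ?thesis
    by (simp add: nop_zero_left[OF is_field_V] nop_scale_right is_field_a is_field_shift[OF is_field_V]
        nop_shift_right)
qed

lemmas V_num = commute_num[OF clin_V V_a V_as]
lemmas V_asnum = commute_asnum[OF clin_V V_a V_as]
lemmas V_asas = commute_asas[OF clin_V V_as]

lemma num_S: "num_mode n (S p v) = S p (num_mode n v) + cscale (- 1) (S (p + n) v)"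
proof -
  have 2: "num_mode n (V r u) = V r (num_mode n u) + 0" for r u
    by (simp add: V_num)
  have "nop (\<lambda>l. a_mode (l + n)) V p v = S (p + n) v + cscale (of_int n) 0"
    by (rule nop_shift_left[OF is_field_a is_field_V, where Z = "\<lambda>s. 0"]) (simp add: V_a)
  moreover have "nop (\<lambda>l u. cscale (- 1) (a_mode (l + n) u)) V p v =
      cscale (- 1) (nop (\<lambda>l. a_mode (l + n)) V p v)"
    by (rule nop_scale_left[OF is_field_shift[OF is_field_a] is_field_V])
  moreover note nop_leibniz[where P = a_mode and Q = V and X = "num_mode n" and Y = "num_mode n" and n = p
      and v = v
      and P' = "\<lambda>r u. cscale (- 1) (a_mode (r + n) u)" and Q' = "\<lambda>r u. 0",
      OF is_field_a is_field_V is_field_scale[OF is_field_shift[OF is_field_a]] is_field_zero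
      clin_currents(4,4) num_a num_a 2]
  ultimately show ?thesis by (simp add: nop_zero_right[OF is_field_a])
qed

text \<open>
  The weight \<open>2\<close> of \<open>a\<close> cancels against the weight \<open>- 2\<close> of \<open>V\<close>.
\<close>
lemma h_S: "h_mode k (- 2) n (S p v) = S p (h_mode k 0 n v)"
  by (simp add: h_mode_def num_S b_S clin_add[OF clin_S] clin_scale[OF clin_S] vec_eq)

lemma asas_a: "asas_mode r (a_mode p v) = a_mode p (asas_mode r v) + cscale (- 2) (as_mode (p + r) v)"
proof -
  have 1: "a_mode p (as_mode l u) = as_mode l (a_mode p u) + (if l = - p then cscale 1 u else 0)" for l u
    by (simp add: a_as_mode)
  from nop_leibniz[where P = as_mode and Q = as_mode and X = "a_mode p" and Y = "a_mode p" and n = r and v = v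
      and P' = "\<lambda>r u. if r = - p then cscale 1 u else 0" and Q' = "\<lambda>r u. if r = - p then cscale 1 u else 0",
      OF is_field_as is_field_as is_field_delta is_field_delta clin_modes(1,1) 1 1 1]
  show ?thesis
    by (simp add: nop_delta_left[OF is_field_as] nop_delta_right[OF is_field_as] vec_eq add.commute)
qed

lemma asas_S: "asas_mode r (S p v) = S p (asas_mode r v) + cscale (- 2) (asv_mode (p + r) v)"
proof -
  have 2: "asas_mode r (V s u) = V s (asas_mode r u) + 0" for s u
    by (simp add: V_asas)
  have "nop (\<lambda>l. as_mode (l + r)) V p v = asv_mode (p + r) v + cscale (of_int r) 0"
    by (rule nop_shift_left[OF is_field_as is_field_V, where Z = "\<lambda>s. 0"]) (simp add: V_as)
  moreover have "nop (\<lambda>l u. cscale (- 2) (as_mode (l + r) u)) V p v =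
      cscale (- 2) (nop (\<lambda>l. as_mode (l + r)) V p v)"
    by (rule nop_scale_left[OF is_field_shift[OF is_field_as] is_field_V])
  moreover note nop_leibniz[where P = a_mode and Q = V and X = "asas_mode r" and Y = "asas_mode r" and n = p
      and v = v
      and P' = "\<lambda>l u. cscale (- 2) (as_mode (l + r) u)" and Q' = "\<lambda>r u. 0",
      OF is_field_a is_field_V is_field_scale[OF is_field_shift[OF is_field_as]] is_field_zero
      field_clin[OF is_field_asas] field_clin[OF is_field_asas] asas_a asas_a 2]
  ultimately show ?thesis by (simp add: nop_zero_right[OF is_field_a])
qed

lemma V_asb: "V r (asb_mode (k + 2) 0 m v) =
    asb_mode (k + 2) (- 2) m (V r v) + cscale 2 (asv_mode (m + r) v)"
proof -
  have 1: "V r (as_mode l u) = as_mode l (V r u) + 0" for l u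
    by (simp add: V_as)
  have 2: "V r (b_mode (k + 2) 0 s u) = b_mode (k + 2) (- 2) s (V r u) + cscale 2 (V (s + r) u)" for s u
    by (simp add: b_v_mode[OF level] vec_eq add.commute)
  have 3: "b_mode (k + 2) (- 2) s 0 = b_mode (k + 2) 0 s 0" for s
    by (simp add: clin_zero[OF clin_modes(3)])
  from nop_leibniz_twisted[where P = as_mode and Q = "b_mode (k + 2) 0" and ?Q2.0 = "b_mode (k + 2) (- 2)"
      and X = "V r" and Y = "V r" and n = m
      and v = v and P' = "\<lambda>l u. 0" and Q' = "\<lambda>s u. cscale 2 (V (s + r) u)",
      OF is_field_as is_field_b is_field_b is_field_zero is_field_scale[OF is_field_shift[OF is_field_V]]
      clin_V clin_V 1 1 2 3]
  show ?thesis
    by (simp add: nop_zero_left[OF is_field_b] nop_scale_right is_field_as is_field_shift[OF is_field_V]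
        nop_shift_right)
qed

lemma f_V: "f_mode k (- 2) m (V r v) = V r (f_mode k 0 m v) + cscale (- 2) (asv_mode (m + r) v)"
  by (simp add: f_mode_def clin_add[OF clin_V] clin_scale[OF clin_V] V_asnum V_as V_asb vec_eq)

lemma h_V: "h_mode k (- 2) n (V r v) = V r (h_mode k 0 n v) + cscale (- 2) (V (r + n) v)"
  by (simp add: h_mode_def clin_add[OF clin_V] clin_scale[OF clin_V] V_num b_v_mode[OF level] vec_eq)

text \<open>
  The deviation from \<open>[f\<^sub>m, S(w)] = (k + 2) \<partial>\<^sub>w (w\<^sup>m V(w))\<close>, of which the coefficient of \<open>w\<^sup>-\<^sup>p\<^sup>-\<^sup>1\<close> is
  taken.
\<close>
definition defect :: "int \<Rightarrow> int \<Rightarrow> wakimoto_space \<Rightarrow> wakimoto_space"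
  where "defect m p v = f_mode k (- 2) m (S p v) - S p (f_mode k 0 m v) +
    cscale ((k + 2) * of_int p) (V (m + p) v)"

lemma clin_defect: "clin (defect m p)"
  unfolding defect_def[abs_def]
  by (intro clin_plus clin_sub clin_cscale clin_V clin_compose[OF clin_f_mode clin_S]
      clin_compose[OF clin_S clin_f_mode])

lemma f_a: "f_mode k \<nu> m (a_mode p v) = a_mode p (f_mode k \<nu> m v) +
    cscale (- 1) (h_mode k \<nu> (m + p) v + (if m = - p then cscale (k * of_int p) v else 0))"
  using a_f[of p k \<nu> m v] by (simp add: vec_eq)

lemma f_b: "f_mode k \<nu> m (b_mode (k + 2) \<nu> p v) = b_mode (k + 2) \<nu> p (f_mode k \<nu> m v) +
    cscale (- (2 * (k + 2) * of_int p)) (as_mode (m + p) v)"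
  using b_f[of k \<nu> p m v] by (simp add: vec_eq)

lemma S_a: "S p (a_mode q v) = a_mode q (S p v)"
  and S_as: "S p (as_mode q v) = as_mode q (S p v) + V (p + q) v"
  and S_b: "S p (b_mode (k + 2) 0 q v) = b_mode (k + 2) (- 2) q (S p v) + cscale 2 (S (p + q) v)"
  and S_h: "S p (h_mode k 0 q v) = h_mode k (- 2) q (S p v)"
  and V_b: "V p (b_mode (k + 2) 0 q v) = b_mode (k + 2) (- 2) q (V p v) + cscale 2 (V (p + q) v)"
  by (simp_all add: a_S as_S b_S h_S b_v_mode[OF level] vec_eq)

lemmas defect_lins = clin_zero[OF clin_S] clin_add[OF clin_S] clin_scale[OF clin_S]
  clin_add[OF clin_f_mode] clin_scale[OF clin_f_mode]
  clin_diff[OF clin_modes(1)] clin_diff[OF clin_modes(2)] clin_diff[OF clin_modes(3)]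
  clin_add[OF clin_modes(1)] clin_add[OF clin_modes(2)] clin_add[OF clin_modes(3)]
  clin_scale[OF clin_modes(1)] clin_scale[OF clin_modes(2)] clin_scale[OF clin_modes(3)]

lemma defect_a: "defect m p (a_mode q v) = a_mode q (defect m p v)"
  by (auto simp: defect_def S_a V_a f_a S_h defect_lins vec_eq algebra_simps)

text \<open>
  Both \<open>[[a\<^sup>*\<^sub>q, f\<^sub>m], S\<^sub>p]\<close> and \<open>[f\<^sub>m, [a\<^sup>*\<^sub>q, S\<^sub>p]]\<close> are twice a mode of \<open>a\<^sup>* V\<close>, with opposite signs.
\<close>
lemma defect_as: "defect m p (as_mode q v) = as_mode q (defect m p v)"
  by (simp add: defect_def S_as V_as f_as f_V asas_S defect_lins vec_eq algebra_simps)

text \<open>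
  The derivative term is forced here: \<open>[b\<^sub>q, f\<^sub>m]\<close> is \<open>2 (k + 2) q\<close> times a mode of \<open>a\<^sup>*\<close>, whose
  commutator with \<open>S\<^sub>p\<close> is a mode of \<open>V\<close>.
\<close>
lemma defect_b: "defect m p (b_mode (k + 2) 0 q v) =
    b_mode (k + 2) (- 2) q (defect m p v) + cscale 2 (defect m (p + q) v)"
  by (simp add: defect_def S_b V_b f_b S_as defect_lins vec_eq algebra_simps)

text \<open>
  Compute the commutator with \<open>h\<^sub>r\<close> twice: from the definition, using \<open>[h\<^sub>r, f\<^sub>m] = - 2 f\<^sub>m\<^sub>+\<^sub>r\<close>, and
  from \<open>h = - 2 :a\<^sup>* a: + b\<close>, of which only \<open>b\<close> fails to commute with the defect.
\<close>
lemma defect_shift: "defect (m + r) p v = defect m (p + r) v"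
proof -
  have "h_mode k (- 2) r (defect m p v) = defect m p (h_mode k 0 r v) + cscale (- 2) (defect (m + r) p v)"
    by (simp add: defect_def clin_add[OF clin_h_mode] clin_diff[OF clin_h_mode] clin_scale[OF clin_h_mode]
        h_f h_S h_V defect_lins vec_eq algebra_simps)
  moreover have "h_mode k (- 2) r (defect m p v) = defect m p (h_mode k 0 r v) + cscale (- 2) (defect m (p + r) v)"
    by (simp add: h_mode_def clin_add[OF clin_defect] clin_scale[OF clin_defect] commute_num[OF clin_defect defect_a defect_as]
        defect_b vec_eq)
  ultimately have "cscale (- 1 / 2) (cscale (- 2) (defect (m + r) p v)) =
      cscale (- 1 / 2) (cscale (- 2) (defect m (p + r) v))" by simp
  then show ?thesis by simp
qed

lemma f_zero_vac: "f_mode k 0 0 wvac = 0"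
proof -
  have num: "num_mode n wvac = 0" if "n \<ge> 0" for n
    using that by (intro num_annihilated) (simp_all add: mode_vac)
  have "(if l \<le> 0 then as_mode l (num_mode (0 - l) wvac) else num_mode (0 - l) (as_mode l wvac)) = 0" for l
    by (simp add: num mode_vac clin_zero[OF clin_currents(4)] clin_zero[OF clin_modes(2)])
  moreover have "(if l \<le> 0 then as_mode l (b_mode (k + 2) 0 (0 - l) wvac)
      else b_mode (k + 2) 0 (0 - l) (as_mode l wvac)) = 0" for l
    using mode_vac(3)[of "- l"] by (cases "l = 0")
      (simp_all add: mode_vac clin_zero[OF clin_modes(3)] clin_zero[OF clin_modes(2)])
  ultimately show ?thesis by (simp add: f_mode_def nop_def)
qed

lemma S_vac: "p \<ge> 0 \<Longrightarrow> S p wvac = 0"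
proof -
  assume p: "p \<ge> 0"
  have "(if l \<le> 0 then a_mode l (V (p - l) wvac) else V (p - l) (a_mode l wvac)) = 0" for l
  proof (cases "l < 0")
    case True
    then show ?thesis using p by (simp add: v_mode_vac(1)[OF level] clin_zero[OF clin_modes(1)])
  next
    case False
    then show ?thesis using mode_vac(1)[of l] V_a[of "p - l" l wvac] by (auto simp: clin_zero[OF clin_V])
  qed
  then show ?thesis by (simp add: nop_def)
qed

text \<open>
  In every term the leftmost operator creates.
\<close>
lemma nop_vac_coeff:
  assumes "\<And>l w. l \<le> 0 \<Longrightarrow> Poly_Mapping.lookup (P l w) (0, 0) = 0"
    and "\<And>l w. l > 0 \<Longrightarrow> Poly_Mapping.lookup (Q (n - l) w) (0, 0) = 0"
  shows "Poly_Mapping.lookup (nop P Q n v) (0, 0) = 0"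
  unfolding nop_def
  by (rule Sum_any_preserves[where P = "\<lambda>w. Poly_Mapping.lookup w (0, 0) = 0"]) (simp_all add: assms lookup_add)

lemma f_zero_vac_coeff: "Poly_Mapping.lookup (f_mode k \<nu> 0 w) (0, 0) = 0"
proof -
  have num: "Poly_Mapping.lookup (num_mode n w) (0, 0) = 0" if "n \<le> 0" for n w
    using that by (intro nop_vac_coeff vac_coeff_creation) auto
  have "Poly_Mapping.lookup (asnum_mode 0 w) (0, 0) = 0" "Poly_Mapping.lookup (asb_mode (k + 2) \<nu> 0 w) (0, 0) = 0"
    by (intro nop_vac_coeff vac_coeff_creation num; simp)+
  then show ?thesis by (simp add: f_mode_def lookup_add)
qed

text \<open>
  For \<open>p \<ge> 0\<close> all three terms vanish.  For \<open>p < 0\<close> the modes \<open>b\<^sub>n\<close> with \<open>n > 0\<close> raise \<open>p\<close>, so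
  by induction the vector is killed by all annihilation modes, and its vacuum
  coefficient is zero because every normally ordered term of \<open>f\<^sub>0\<close> starts with a creation mode.
\<close>
lemma defect_zero_vac: "defect 0 p wvac = 0"
proof (induction "nat (- p)" arbitrary: p rule: less_induct)
  case less
  show ?case
  proof (cases "p \<ge> 0")
    case True
    then show ?thesis
      by (cases "p = 0")
        (simp_all add: defect_def S_vac f_zero_vac clin_zero[OF clin_S] clin_zero[OF clin_f_mode] v_mode_vac(1)[OF level])
  next
    case False
    show ?thesis
    proof (rule annihilated_zero[OF level])
      show "a_mode n (defect 0 p wvac) = 0" if "n \<ge> 0" for n
        using that by (simp add: mode_vac clin_zero[OF clin_defect] flip: defect_a)
      show "as_mode n (defect 0 p wvac) = 0" if "n > 0" for n
        using that by (simp add: mode_vac clin_zero[OF clin_defect] flip: defect_as)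
      show "b_mode (k + 2) (- 2) n (defect 0 p wvac) = 0" if "n > 0" for n
      proof -
        have "defect 0 (p + n) wvac = 0" using that False by (intro less) simp
        then show ?thesis using defect_b[of 0 p n wvac] that by (simp add: mode_vac clin_zero[OF clin_defect])
      qed
      show "Poly_Mapping.lookup (defect 0 p wvac) (0, 0) = 0"
        using False by (simp add: defect_def f_zero_vac clin_zero[OF clin_S] lookup_add f_zero_vac_coeff
            v_mode_vac(2)[OF level])
    qed
  qed
qed

lemma defect_zero: "defect 0 p v = 0"
proof -
  \<comment> \<open>The modes of \<open>b\<close> change \<open>p\<close>, so all \<open>p\<close> are treated simultaneously.\<close>
  have "\<forall>p. defect 0 p v = 0"
    by (rule wakimoto_induct[where P = "\<lambda>v. \<forall>p. defect 0 p v = 0" and \<kappa> = "k + 2" and \<nu> = 0])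
      (simp_all add: defect_zero_vac defect_a defect_as defect_b clin_add[OF clin_defect] clin_scale[OF clin_defect]
        clin_zero[OF clin_modes(1)] clin_zero[OF clin_modes(2)] clin_zero[OF clin_modes(3)])
  then show ?thesis by blast
qed

text \<open>
  A total derivative has no residue: its coefficient with \<open>p = 0\<close> carries the factor \<open>p\<close>.
\<close>
lemma f_S: "f_mode k (- 2) m (S 0 v) = S 0 (f_mode k 0 m v)"
proof -
  have "defect m 0 v = 0" using defect_shift[of 0 m 0 v] by (simp add: defect_zero)
  then show ?thesis by (simp add: defect_def)
qed

end

section \<open>Modules from fields\<close>

lemma clin_action: "clin (\<lambda>X. action_of_fields k \<phi> X v)"
  unfolding action_of_fields_def by (rule clin_linext)

lemma action_single: "action_of_fields k \<phi> (Poly_Mapping.single g c) v = cscale c (affine_basis_action k \<phi> g v)"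
  by (simp add: action_of_fields_def)

lemma action_of_fields_clin:
  assumes "\<And>x i. clin (\<phi> x i)"
  shows "clin (action_of_fields k \<phi> X)"
proof -
  have g: "clin (affine_basis_action k \<phi> g)" for g
  proof (cases g)
    case Central
    then show ?thesis by (simp add: clin_iff mult.commute)
  next
    case (Loop x n)
    have "affine_basis_action k \<phi> g = \<phi> x (- n - 1)" using Loop by auto
    then show ?thesis using assms by simp
  qed
  show ?thesis
    by (auto simp: clin_iff action_of_fields_def linext_def clin_add[OF g] clin_scale[OF g] sum.distrib
        cscale_sum mult_ac)
qed

lemma affine_bracket_clin: "clin (\<lambda>X. affine_bracket X Y)" "clin (affine_bracket X)"
proof -
  show "clin (\<lambda>X. affine_bracket X Y)" unfolding affine_bracket_def by (rule clin_linext)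
  show "clin (affine_bracket X)"
    by (auto simp: clin_iff affine_bracket_def linext_def[of _ X] clin_add[OF clin_linext]
        clin_scale[OF clin_linext] sum.distrib cscale_sum mult_ac)
qed

text \<open>
  By bilinearity the module axiom has to be checked on basis elements, and the central ones act by
  scalars.
\<close>
lemma affine_module_action_of_fields:
  assumes lin: "\<And>x i. clin (\<phi> x i)"
    and comm: "\<And>x y n m v. action_of_fields k \<phi> (affine_basis_bracket (Loop x n) (Loop y m)) v =
      \<phi> x (- n - 1) (\<phi> y (- m - 1) v) - \<phi> y (- m - 1) (\<phi> x (- n - 1) v)"
  shows "affine_module (action_of_fields k \<phi>)"
  unfolding affine_module_def
proof (intro conjI allI)
  let ?\<rho> = "action_of_fields k \<phi>"
  note rho = action_of_fields_clin[of \<phi>, OF lin]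
  show "clin (?\<rho> X)" for X by (rule rho)
  show "clin (\<lambda>X. ?\<rho> X v)" for v by (rule clin_action)
  have basis: "?\<rho> (affine_basis_bracket g h) v = affine_basis_action k \<phi> g (affine_basis_action k \<phi> h v) -
      affine_basis_action k \<phi> h (affine_basis_action k \<phi> g v)" for g h v
    by (cases g; cases h)
      (simp_all add: comm clin_scale[OF lin] clin_zero[OF clin_action] mult.commute del: affine_basis_bracket.simps(1))
  fix X Y v
  show "?\<rho> (affine_bracket X Y) v = ?\<rho> X (?\<rho> Y v) - ?\<rho> Y (?\<rho> X v)"
  proof (rule clin_eqI[OF clin_compose[OF clin_action affine_bracket_clin(1)]
        clin_sub[OF clin_action clin_compose[OF rho clin_action]]])
    fix g
    show "?\<rho> (affine_bracket (Poly_Mapping.single g 1) Y) v =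
        ?\<rho> (Poly_Mapping.single g 1) (?\<rho> Y v) - ?\<rho> Y (?\<rho> (Poly_Mapping.single g 1) v)"
      by (rule clin_eqI[OF clin_compose[OF clin_action affine_bracket_clin(2)]
            clin_sub[OF clin_compose[OF rho clin_action] clin_action]])
        (simp add: affine_bracket_def action_single basis)
  qed
qed

section \<open>Modes of the Wakimoto fields and the screening operator\<close>

lemma Sum_any_uminus: "Sum_any (\<lambda>l::int. g (- l)) = Sum_any g"
proof -
  have "bij (\<lambda>l::int. - l)" by (rule bij_uminus)
  from Sum_any.reindex_cong[OF this refl, of g] show ?thesis by (simp add: o_def)
qed

lemma as_field_mode: "as_field j = as_mode (- j)"
  by (simp add: as_field_def as_mode_def)

lemma a_field_mode: "a_field j = a_mode (- j - 1)"
  by (simp add: a_field_def a_mode_def)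

lemma b_field_mode: "b_field \<kappa> \<nu> j = b_mode \<kappa> \<nu> (- j - 1)"
  by (simp add: b_field_def b_mode_def)

text \<open>
  The coefficient of \<open>z\<^sup>j\<close> in \<open>a\<^sup>*\<close> is the mode of index \<open>- j\<close>, and in a field of weight \<open>1\<close> it is the
  mode of index \<open>- j - 1\<close>; so nonnegative powers correspond to the indices that \<open>nop\<close> puts on the
  left.
\<close>
lemma normal_prod_mode:
  assumes A: "\<And>j. A j = Q (- j - 1)" and Q: "is_field Q"
  shows "normal_prod as_field A i v = nop as_mode Q (- i - 1) v"
proof -
  let ?n = "- i - 1"
  let ?f = "\<lambda>l. if l \<le> 0 then as_mode l (Q (?n - l) v) else 0"
  let ?g = "\<lambda>l. if l \<le> 0 then 0 else Q (?n - l) (as_mode l v)"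
  have fin: "finite {l. ?f l \<noteq> 0}" "finite {l. ?g l \<noteq> 0}"
    by (rule finite_subset[OF _ nop_finite[OF is_field_as Q, of ?n v]]; auto)+
  have "Sum_any (\<lambda>j. dist_pos as_field j (A (i - j) v)) = Sum_any (\<lambda>j. ?f (- j))"
    by (rule Sum_any.cong) (simp add: dist_pos_def A as_field_mode algebra_simps)
  moreover have "Sum_any (\<lambda>j. A j (dist_neg as_field (i - j) v)) = Sum_any (\<lambda>j. ?g (j + (- i)))"
  proof (rule Sum_any.cong)
    have reindex: "A j (dist_neg as_field (i - j) v) = ?g l" if "j = l + i" for j l
    proof -
      have shift: "- j - 1 = ?n - l" "i - j = - l" using that by simp_all
      show ?thesis
        unfolding A shift by (simp add: dist_neg_def as_field_mode clin_zero[OF field_clin[OF Q]])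
    qed
    show "A j (dist_neg as_field (i - j) v) = ?g (j + (- i))" for j
      by (rule reindex) simp
  qed
  moreover have "Sum_any (\<lambda>j. ?g (j + (- i))) = Sum_any ?g"
    by (rule Sum_any_shift)
  moreover have "nop as_mode Q ?n v = Sum_any (\<lambda>l. ?f l + ?g l)"
    unfolding nop_def by (rule Sum_any.cong) simp
  ultimately show ?thesis
    unfolding normal_prod_def dist_add_def dist_mult_def
    using Sum_any_uminus[of ?f] Sum_any.distrib[OF fin] by simp
qed

lemma dist_mult_mode:
  assumes A: "\<And>j. A j = Q (- j - 1)" and Q: "is_field Q"
    and comm: "\<And>l r v. Q r (as_mode l v) = as_mode l (Q r v)"
  shows "dist_mult as_field A i v = nop as_mode Q (- i - 1) v"
proof -
  have "dist_mult as_field A i v = Sum_any (\<lambda>j. as_mode (- j) (Q (- i - 1 - (- j)) v))"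
    unfolding dist_mult_def by (rule Sum_any.cong) (simp add: A as_field_mode algebra_simps)
  also have "\<dots> = Sum_any (\<lambda>l. as_mode l (Q (- i - 1 - l) v))"
    by (rule Sum_any_uminus)
  finally show ?thesis by (simp add: nop_def comm cong: if_cong)
qed

lemma wakimoto_field_modes:
  "wakimoto_field \<nu> k E i = a_mode (- i - 1)"
  "wakimoto_field \<nu> k H i = h_mode k \<nu> (- i - 1)"
  "wakimoto_field \<nu> k F i = f_mode k \<nu> (- i - 1)"
proof -
  have num: "normal_prod as_field a_field j = num_mode (- j - 1)" for j
    by (rule ext) (rule normal_prod_mode[OF a_field_mode is_field_a])
  have asnum: "normal_prod as_field (normal_prod as_field a_field) j = asnum_mode (- j - 1)" for j
    by (rule ext) (rule normal_prod_mode[OF num is_field_num])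
  have asb: "dist_mult as_field (b_field (k + 2) \<nu>) j = asb_mode (k + 2) \<nu> (- j - 1)" for j
    by (rule ext) (rule dist_mult_mode[OF b_field_mode is_field_b b_as_mode])
  show "wakimoto_field \<nu> k E i = a_mode (- i - 1)" by (simp add: a_field_mode)
  show "wakimoto_field \<nu> k H i = h_mode k \<nu> (- i - 1)"
    by (rule ext) (simp add: dist_add_def dist_scale_def num b_field_mode h_mode_def)
  show "wakimoto_field \<nu> k F i = f_mode k \<nu> (- i - 1)"
    by (rule ext) (simp add: dist_add_def dist_scale_def dist_deriv_def asnum asb as_field_mode f_mode_def
        algebra_simps)
qed

lemma wakimoto_module: "affine_module (wakimoto \<nu> k)"
  unfolding wakimoto_def
proof (rule affine_module_action_of_fields)
  show "clin (wakimoto_field \<nu> k x i)" for x i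
    by (cases x) (simp_all only: wakimoto_field_modes clin_modes clin_h_mode clin_f_mode)
  fix x y n m v
  show "action_of_fields k (wakimoto_field \<nu> k) (affine_basis_bracket (Loop x n) (Loop y m)) v =
    wakimoto_field \<nu> k x (- n - 1) (wakimoto_field \<nu> k y (- m - 1) v) -
    wakimoto_field \<nu> k y (- m - 1) (wakimoto_field \<nu> k x (- n - 1) v)"
    using a_a_mode[of n m v] h_h[of k \<nu> n m v] f_f[of k \<nu> n m v]
      h_a[of k \<nu> n m v] h_a[of k \<nu> m n v] h_f[of k \<nu> n m v] h_f[of k \<nu> m n v]
      a_f[of n k \<nu> m v] a_f[of m k \<nu> n v]
    by (cases x; cases y) (auto simp: wakimoto_field_modes clin_add[OF clin_action] action_single
        clin_zero[OF clin_linext] clin_zero[OF clin_action] vec_eq add_eq_0_iff algebra_simps simp del: wakimoto_field.simps)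
qed

lemma screening_op_mode:
  assumes "k + 2 \<noteq> 0"
  shows "screening_op k v = nop a_mode (v_mode (k + 2)) 0 v"
proof -
  let ?g = "\<lambda>l. a_mode l (v_mode (k + 2) (0 - l) v)"
  have "screening_op k v = Sum_any (\<lambda>j. ?g (- (j + 1)))"
    unfolding screening_op_def dist_residue_def screening_field_def dist_mult_def
  proof (rule Sum_any.cong)
    have reindex: "a_field j (tensor_map id (vertex_op (k + 2) (- 1 - j)) v) = ?g l" if "j = - l - 1" for j l
      unfolding that a_field_mode v_mode_def by simp
    show "a_field j (tensor_map id (vertex_op (k + 2) (- 1 - j)) v) = ?g (- (j + 1))" for j
      by (rule reindex) simp
  qed
  also have "\<dots> = Sum_any ?g"
    using Sum_any_shift[of "\<lambda>j. ?g (- j)" 1] Sum_any_uminus[of ?g] by simp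
  finally show ?thesis by (simp add: nop_def v_a_mode[OF assms] cong: if_cong)
qed

theorem proposition7p1:
  fixes k :: complex
  assumes "k \<noteq> - 2"
  shows "intertwining_operator (wakimoto 0 k) (wakimoto (- 2) k) (screening_op k)"
proof -
  have level: "k + 2 \<noteq> 0" using assms by (simp add: eq_neg_iff_add_eq_0)
  have S: "screening_op k = nop a_mode (v_mode (k + 2)) 0"
    by (rule ext) (rule screening_op_mode[OF level])
  have lin: "clin (screening_op k)"
    unfolding S by (rule clin_S[OF level])
  have basis: "screening_op k (affine_basis_action k (wakimoto_field 0 k) g v) =
      affine_basis_action k (wakimoto_field (- 2) k) g (screening_op k v)" for g v
  proof (cases g)
    case Central
    then show ?thesis by (simp add: clin_scale[OF lin])
  next
    case (Loop x n)
    then show ?thesis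
      by (cases x) (simp_all add: S wakimoto_field_modes a_S[OF level] h_S[OF level] f_S[OF level]
          del: wakimoto_field.simps)
  qed
  have "screening_op k (wakimoto 0 k X v) = wakimoto (- 2) k X (screening_op k v)" for X v
    unfolding wakimoto_def
    by (rule clin_eqI[OF clin_compose[OF lin clin_action] clin_action]) (simp add: action_single basis)
  then show ?thesis
    unfolding intertwining_operator_def using wakimoto_module lin by blast
qed

end
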